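(* Let $n\geq 2$ and let $|\psi\rangle\in\bigotimes_{i=1}^n\mathcal H_{d_i}$ be an $n$-partite pure quantum state. In each item below the group representation is assumed to have nontrivial adjoint action on at least one party. Then: (a) $|\psi\rangle$ cannot be both 2-uniform and $U(1)$-invariant. (b) $|\psi\rangle$ cannot be both 2-uniform and $SU(2)$-invariant. (c) If $d_i=d$ for all $i\in\{1,\dots,n\}$, then $|\psi\rangle$ cannot be both 2-uniform and $U(d)$-invariant with respect to the fundamental representation of $U(d)$ on every party. (d) If $n\ge4$, then $|\psi\rangle$ cannot be both absolutely maximally entangled (AME) and $SU(2)$-invariant with respect to the $d_i$-dimensional irreducible representations of $SU(2)$.
   Context: $\mathcal H_d=\mathbb C^d$. A state $|\psi\rangle$ (a unit vector) is called $G$-invariant with respect to continuous representations $R^{(i)}:G\to GL(\mathbb C^{d_i})$ if, with $R(g)=\bigotimes_{i=1}^n R^{(i)}(g)$, one has $R(g)|\psi\rangle\langle\psi|R(g)^\dagger=|\psi\rangle\langle\psi|$ for all $g\in G$. The adjoint action is nontrivial on party $k$ if the maps $X\mapsto R^{(k)}(g)XR^{(k)}(g)^\dagger$ on $d_k\times d_k$ matrices are not all the identity ($g\in G$). For a set of parties $\mathcal A$ the marginal is $\rho_{\mathcal A}=\operatorname{tr}_{\mathcal A^c}|\psi\rangle\langle\psi|$; it is maximally mixed if $\rho_{\mathcal A}\propto\mathbb 1$. The state is $k$-uniform if $\rho_{\mathcal A}$ is maximally mixed for every set $\mathcal A$ of $k$ parties, and AME if it is $\lfloor n/2\rfloor$-uniform.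 *)

theory Defs
  imports
    "HOL-Analysis.Analysis"
    "HOL-Algebra.Group"
    "Jordan_Normal_Form.Schur_Decomposition"
    "Jordan_Normal_Form.VS_Connect"
begin

section \<open>Matrix groups and their representations\<close>

definition GL_group :: "nat \<Rightarrow> complex mat monoid" where
  "GL_group m = units_of (ring_mat TYPE(complex) m ())"

definition U_group :: "nat \<Rightarrow> complex mat monoid" where
  "U_group m = (GL_group m)
     \<lparr>carrier := {A \<in> carrier_mat m m. A * mat_adjoint A = 1\<^sub>m m \<and> mat_adjoint A * A = 1\<^sub>m m}\<rparr>"

definition SU_group :: "nat \<Rightarrow> complex mat monoid" where
  "SU_group m = (GL_group m)\<lparr>carrier := {A \<in> carrier (U_group m). Determinant.det A = 1}\<rparr>"

text \<open>The usual topology of the space of complex \<open>m\<close> by \<open>m\<close> matrices (entrywise convergence).\<close>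

definition mat_topology :: "nat \<Rightarrow> complex mat topology" where
  "mat_topology m = pullback_topology (carrier_mat m m)
     (\<lambda>A. \<lambda>ij\<in>{..<m} \<times> {..<m}. A $$ ij)
     (product_topology (\<lambda>_. euclidean) ({..<m} \<times> {..<m}))"

text \<open>\<open>cont_rep m G d R\<close>: the map \<open>R\<close> is a continuous representation on \<open>\<complex>\<^sup>d\<close> of
  the group \<open>G\<close> of \<open>m\<close> by \<open>m\<close> matrices. It need not be unitary.\<close>

definition cont_rep ::
  "nat \<Rightarrow> complex mat monoid \<Rightarrow> nat \<Rightarrow> (complex mat \<Rightarrow> complex mat) \<Rightarrow> bool" where
  "cont_rep m G d R \<longleftrightarrow>
     R \<in> hom G (GL_group d) \<and>
     continuous_map (subtopology (mat_topology m) (carrier G)) (mat_topology d) R"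

definition irreducible_rep ::
  "complex mat monoid \<Rightarrow> nat \<Rightarrow> (complex mat \<Rightarrow> complex mat) \<Rightarrow> bool" where
  "irreducible_rep G d R \<longleftrightarrow> d \<noteq> 0 \<and>
     (\<forall>W. VectorSpace.subspace class_ring W (module_vec TYPE(complex) d) \<and>
          (\<forall>g\<in>carrier G. \<forall>w\<in>W. R g *\<^sub>v w \<in> W)
        \<longrightarrow> W = {0\<^sub>v d} \<or> W = carrier_vec d)"

definition nontrivial_adjoint ::
  "complex mat monoid \<Rightarrow> nat \<Rightarrow> (complex mat \<Rightarrow> complex mat) \<Rightarrow> bool" where
  "nontrivial_adjoint G d R \<longleftrightarrow>
     \<not> (\<forall>g\<in>carrier G. \<forall>X\<in>carrier_mat d d. R g * X * mat_adjoint (R g) = X)"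

section \<open>Multipartite states\<close>

text \<open>The parties are \<open>1, \<dots>, n\<close>, with local dimensions \<open>d i\<close>. The product basis of the
  tensor product over a set \<open>A\<close> of parties is indexed by \<open>basis_idx d A\<close>. A vector is given
  by its coefficients and an operator by its matrix entries in that basis; only the values on
  basis indices are meaningful.\<close>

definition basis_idx :: "(nat \<Rightarrow> nat) \<Rightarrow> nat set \<Rightarrow> (nat \<Rightarrow> nat) set" where
  "basis_idx d A = (\<Pi>\<^sub>E i\<in>A. {..<d i})"

type_synonym ket = "(nat \<Rightarrow> nat) \<Rightarrow> complex"
type_synonym operator = "(nat \<Rightarrow> nat) \<Rightarrow> (nat \<Rightarrow> nat) \<Rightarrow> complex"

definition is_state :: "nat \<Rightarrow> (nat \<Rightarrow> nat) \<Rightarrow> ket \<Rightarrow> bool" where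
  "is_state n d \<psi> \<longleftrightarrow> (\<Sum>x\<in>basis_idx d {1..n}. (cmod (\<psi> x))\<^sup>2) = 1"

definition projector :: "ket \<Rightarrow> operator" where
  "projector \<psi> = (\<lambda>x y. \<psi> x * cnj (\<psi> y))"

definition op_mult :: "(nat \<Rightarrow> nat) set \<Rightarrow> operator \<Rightarrow> operator \<Rightarrow> operator" where
  "op_mult B S T = (\<lambda>x y. \<Sum>z\<in>B. S x z * T z y)"

definition op_adjoint :: "operator \<Rightarrow> operator" where
  "op_adjoint S = (\<lambda>x y. cnj (S y x))"

definition tensor_op :: "nat \<Rightarrow> (nat \<Rightarrow> complex mat) \<Rightarrow> operator" where
  "tensor_op n M = (\<lambda>x y. \<Prod>i\<in>{1..n}. M i $$ (x i, y i))"

definition invariant_state ::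
  "nat \<Rightarrow> (nat \<Rightarrow> nat) \<Rightarrow> complex mat monoid \<Rightarrow> (nat \<Rightarrow> complex mat \<Rightarrow> complex mat) \<Rightarrow> ket \<Rightarrow> bool" where
  "invariant_state n d G R \<psi> \<longleftrightarrow>
     (let B = basis_idx d {1..n} in
      \<forall>g\<in>carrier G. let T = tensor_op n (\<lambda>i. R i g) in
        \<forall>x\<in>B. \<forall>y\<in>B.
          op_mult B (op_mult B T (projector \<psi>)) (op_adjoint T) x y = projector \<psi> x y)"

text \<open>The partial trace over the parties outside \<open>A\<close>.\<close>

definition marginal :: "nat \<Rightarrow> (nat \<Rightarrow> nat) \<Rightarrow> ket \<Rightarrow> nat set \<Rightarrow> operator" where
  "marginal n d \<psi> A = (\<lambda>x y. \<Sum>z\<in>basis_idx d ({1..n} - A).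
     projector \<psi> (merge A ({1..n} - A) (x, z)) (merge A ({1..n} - A) (y, z)))"

definition maximally_mixed :: "(nat \<Rightarrow> nat) \<Rightarrow> nat set \<Rightarrow> operator \<Rightarrow> bool" where
  "maximally_mixed d A \<rho> \<longleftrightarrow>
     (\<exists>c. \<forall>x\<in>basis_idx d A. \<forall>y\<in>basis_idx d A. \<rho> x y = (if x = y then c else 0))"

definition k_uniform :: "nat \<Rightarrow> (nat \<Rightarrow> nat) \<Rightarrow> nat \<Rightarrow> ket \<Rightarrow> bool" where
  "k_uniform n d k \<psi> \<longleftrightarrow>
     (\<forall>A. A \<subseteq> {1..n} \<and> card A = k \<longrightarrow> maximally_mixed d A (marginal n d \<psi> A))"

definition AME :: "nat \<Rightarrow> (nat \<Rightarrow> nat) \<Rightarrow> ket \<Rightarrow> bool" where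
  "AME n d \<psi> \<longleftrightarrow> k_uniform n d (n div 2) \<psi>"

end

theory Submission
  imports Defs
begin

text \<open>
  For \<open>g\<close> near the identity write \<open>R\<^sub>i(g) = c\<^sub>i (1 + F\<^sub>i)\<close> with \<open>F\<^sub>i\<close> traceless. Two-uniformity makes
  the vectors \<open>F\<^sub>i \<psi>\<close> pairwise orthogonal and orthogonal to \<open>\<psi>\<close>, with
  \<open>\<parallel>F\<^sub>i \<psi>\<parallel>\<^sup>2 = \<parallel>F\<^sub>i\<parallel>\<^sup>2 / d\<^sub>i\<close>. Invariance says that \<open>\<psi>\<close> is an eigenvector of \<open>\<Otimes>\<^sub>i (1 + F\<^sub>i)\<close>, so the
  component \<open>\<Sum>\<^sub>i F\<^sub>i \<psi>\<close> orthogonal to \<open>\<psi>\<close> is of second order in \<open>F\<close>; for small \<open>F\<close> this forces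
  \<open>F = 0\<close>. Hence every \<open>R\<^sub>i\<close> is scalar near the identity, therefore scalar along every one-parameter
  group, and on a periodic one the scalars are bounded, so they have modulus one. Periodic one-parameter groups
  cover \<open>U(1)\<close> and \<open>SU(2)\<close>;
  in \<open>U(d)\<close> the group \<open>diag(e\<^sup>i\<^sup>t, 1, \<dots>, 1)\<close> is not scalar unless \<open>d = 1\<close>. Finally AME with
  \<open>n \<ge> 4\<close> implies two-uniformity, so (d) follows from (b).
\<close>

declare One_nat_def [simp del]

subsection \<open>Marginals\<close>

lemma finite_basis_idx [simp]: "finite A \<Longrightarrow> finite (basis_idx d A)"
  by (simp add: basis_idx_def finite_PiE)

lemma basis_idx_less: "x \<in> basis_idx d A \<Longrightarrow> i \<in> A \<Longrightarrow> x i < d i"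
  by (auto simp: basis_idx_def PiE_def)

lemma basis_idx_eqI:
  "x \<in> basis_idx d A \<Longrightarrow> y \<in> basis_idx d A \<Longrightarrow> (\<And>i. i \<in> A \<Longrightarrow> x i = y i) \<Longrightarrow> x = y"
  unfolding basis_idx_def by (rule PiE_ext)

lemma basis_idx_upd:
  "x \<in> basis_idx d A \<Longrightarrow> i \<in> A \<Longrightarrow> a < d i \<Longrightarrow> x(i := a) \<in> basis_idx d A"
  by (auto simp: basis_idx_def PiE_def extensional_def)

lemma merge_basis_idx:
  "A \<inter> C = {} \<Longrightarrow> y \<in> basis_idx d A \<Longrightarrow> z \<in> basis_idx d C \<Longrightarrow> merge A C (y, z) \<in> basis_idx d (A \<union> C)"
  by (auto simp: basis_idx_def PiE_def)

lemma merge_upd: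
  "i \<in> A \<Longrightarrow> (merge A C (y, z))(i := a) = merge A C (y(i := a), z)"
  by (auto simp: merge_def fun_eq_iff)

text \<open>For disjoint \<open>A\<close> and \<open>C\<close>, \<open>merge\<close> is a bijection
  whose inverse is the pair of restrictions: the basis of a tensor product factorises along the
  partition.\<close>

lemma sum_basis_merge:
  assumes "A \<inter> C = {}"
  shows "(\<Sum>x\<in>basis_idx d (A \<union> C). G x) =
    (\<Sum>y\<in>basis_idx d A. \<Sum>z\<in>basis_idx d C. G (merge A C (y, z)))"
proof -
  have "(\<Sum>x\<in>basis_idx d (A \<union> C). G x) = (\<Sum>p\<in>basis_idx d A \<times> basis_idx d C. G (merge A C p))"
  proof (rule sum.reindex_bij_witness[where i = "merge A C" and j = "\<lambda>x. (restrict x A, restrict x C)"])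
    fix x assume x: "x \<in> basis_idx d (A \<union> C)"
    then show "merge A C (restrict x A, restrict x C) = x"
      by (auto simp: basis_idx_def PiE_def extensional_restrict)
    then show "G (merge A C (restrict x A, restrict x C)) = G x" by simp
    show "(restrict x A, restrict x C) \<in> basis_idx d A \<times> basis_idx d C"
      using x by (auto simp: basis_idx_def PiE_def)
  next
    fix p assume p: "p \<in> basis_idx d A \<times> basis_idx d C"
    then show "(restrict (merge A C p) A, restrict (merge A C p) C) = p"
      using assms by (cases p) (simp add: basis_idx_def PiE_def extensional_restrict)
    show "merge A C p \<in> basis_idx d (A \<union> C)"
      using p assms merge_basis_idx by (cases p) auto
  qed
  then show ?thesis by (simp add: sum.cartesian_product)
qed

lemma sum_basis_pair:
  assumes "i \<noteq> j"
  shows "(\<Sum>y\<in>basis_idx d {i, j}. G (y i) (y j)) = (\<Sum>p<d i. \<Sum>q<d j. G p q)"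
proof -
  have "(\<Sum>y\<in>basis_idx d {i, j}. G (y i) (y j)) = (\<Sum>(p, q)\<in>{..<d i} \<times> {..<d j}. G p q)"
    by (rule sum.reindex_bij_witness[where j = "\<lambda>y. (y i, y j)"
          and i = "\<lambda>(p, q). \<lambda>k\<in>{i, j}. if k = i then p else q"])
       (use assms in \<open>auto simp: basis_idx_def PiE_def extensional_def fun_eq_iff\<close>)
  then show ?thesis by (simp add: sum.cartesian_product)
qed

text \<open>Partial traces compose: the marginal on \<open>C\<close> arises from the one on
  \<open>A\<close> by tracing out \<open>A - C\<close>, and the trace of a multiple of the identity
  is again such a multiple, with the dimension of the traced factor as additional
  coefficient.\<close>

lemma maximally_mixed_subset:
  assumes mixed: "maximally_mixed d A (marginal n d \<psi> A)" and CA: "C \<subseteq> A" and An: "A \<subseteq> {1..n}"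
  shows "maximally_mixed d C (marginal n d \<psi> C)"
proof -
  obtain c where c: "\<And>x y. x \<in> basis_idx d A \<Longrightarrow> y \<in> basis_idx d A \<Longrightarrow>
      marginal n d \<psi> A x y = (if x = y then c else 0)"
    using mixed unfolding maximally_mixed_def by blast
  have split: "{1..n} - C = (A - C) \<union> ({1..n} - A)" and disj: "(A - C) \<inter> ({1..n} - A) = {}"
    using CA An by auto
  have "marginal n d \<psi> C x y = (if x = y then of_nat (card (basis_idx d (A - C))) * c else 0)"
    if x: "x \<in> basis_idx d C" and y: "y \<in> basis_idx d C" for x y
  proof -
    have assoc: "merge C ({1..n} - C) (x, merge (A - C) ({1..n} - A) (w, z)) =
        merge A ({1..n} - A) (merge C (A - C) (x, w), z)" for x w z
      using CA An by (auto simp: merge_def fun_eq_iff)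
    have "marginal n d \<psi> C x y = (\<Sum>w\<in>basis_idx d (A - C).
        marginal n d \<psi> A (merge C (A - C) (x, w)) (merge C (A - C) (y, w)))"
      unfolding marginal_def by (subst split, subst sum_basis_merge[OF disj]) (simp add: assoc)
    also have "\<dots> = (\<Sum>w\<in>basis_idx d (A - C). if x = y then c else 0)"
    proof (rule sum.cong[OF refl])
      fix w assume w: "w \<in> basis_idx d (A - C)"
      have un: "C \<union> (A - C) = A" using CA by auto
      have "merge C (A - C) (x, w) \<in> basis_idx d A" "merge C (A - C) (y, w) \<in> basis_idx d A"
        using merge_basis_idx[OF _ x w] merge_basis_idx[OF _ y w] unfolding un by auto
      moreover have "merge C (A - C) (x, w) = merge C (A - C) (y, w) \<longleftrightarrow> x = y"
      proof
        assume "merge C (A - C) (x, w) = merge C (A - C) (y, w)"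
        then have "x i = y i" if "i \<in> C" for i
          using that by (metis Diff_disjoint merge_apply(1))
        then show "x = y" by (rule basis_idx_eqI[OF x y])
      qed simp
      ultimately show "marginal n d \<psi> A (merge C (A - C) (x, w)) (merge C (A - C) (y, w)) =
          (if x = y then c else 0)"
        using c by simp
    qed
    finally show ?thesis by simp
  qed
  then show ?thesis unfolding maximally_mixed_def by blast
qed

text \<open>Because \<open>k \<le> n\<close>, every set of \<open>l\<close> parties extends to one
  of \<open>k\<close> parties, whose marginal can then be traced further.\<close>

lemma k_uniform_mono:
  assumes "k_uniform n d k \<psi>" "l \<le> k" "k \<le> n"
  shows "k_uniform n d l \<psi>"
  unfolding k_uniform_def
proof (intro allI impI, elim conjE)
  fix C assume C: "C \<subseteq> {1..n}" "card C = l"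
  obtain A where A: "C \<subseteq> A" "A \<subseteq> {1..n}" "card A = k"
    using exists_subset_between[of C k "{1..n}"] C assms by auto
  show "maximally_mixed d C (marginal n d \<psi> C)"
    using maximally_mixed_subset[OF _ A(1,2)] assms(1) A unfolding k_uniform_def by blast
qed

text \<open>Everything apart from \<open>\<psi>\<close> lives on \<open>A\<close>: the weight
  \<open>g\<close> ignores the coordinates outside \<open>A\<close>, and both updates happen inside
  \<open>A\<close>. Summing over the outside coordinates therefore produces exactly an entry of the
  marginal.\<close>

lemma marginal_expectation:
  assumes An: "A \<subseteq> {1..n}"
    and mixed: "\<And>x y. x \<in> basis_idx d A \<Longrightarrow> y \<in> basis_idx d A \<Longrightarrow>
      marginal n d \<psi> A x y = (if x = y then c else 0)"
    and i: "i \<in> A" "a < d i" and j: "j \<in> A" "b < d j"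
    and g: "\<And>y z. g (merge A ({1..n} - A) (y, z)) = g y"
  shows "(\<Sum>x\<in>basis_idx d {1..n}. g x * (\<psi> (x(i := a)) * cnj (\<psi> (x(j := b))))) =
    c * (\<Sum>y\<in>basis_idx d A. if y(i := a) = y(j := b) then g y else 0)"
proof -
  have un: "{1..n} = A \<union> ({1..n} - A)" using An by auto
  have "(\<Sum>x\<in>basis_idx d {1..n}. g x * (\<psi> (x(i := a)) * cnj (\<psi> (x(j := b))))) =
    (\<Sum>y\<in>basis_idx d A. g y * marginal n d \<psi> A (y(i := a)) (y(j := b)))"
    by (subst un, subst sum_basis_merge)
       (auto simp: g merge_upd i j marginal_def projector_def sum_distrib_left)
  also have "\<dots> = (\<Sum>y\<in>basis_idx d A. c * (if y(i := a) = y(j := b) then g y else 0))"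
    by (rule sum.cong[OF refl]) (simp add: mixed basis_idx_upd i j)
  finally show ?thesis by (simp add: sum_distrib_left)
qed

section \<open>Operators acting on one party, and their inner products\<close>

definition local_op :: "(nat \<Rightarrow> nat) \<Rightarrow> nat \<Rightarrow> (nat \<Rightarrow> nat \<Rightarrow> complex) \<Rightarrow> ket \<Rightarrow> ket" where
  "local_op d i F \<psi> x = (\<Sum>a<d i. F (x i) a * \<psi> (x(i := a)))"

lemma local_op_inner:
  "cnj (local_op d i E \<psi> x) * local_op d j F \<psi> x =
    (\<Sum>a<d i. \<Sum>b<d j. (cnj (E (x i) a) * F (x j) b) * (\<psi> (x(j := b)) * cnj (\<psi> (x(i := a)))))"
  unfolding local_op_def cnj_sum sum_product by (intro sum.cong refl) (simp add: mult_ac)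

lemma local_op_id:
  assumes "x \<in> basis_idx d {1..n}" "i \<in> {1..n}"
  shows "local_op d i (\<lambda>a b. if a = b then 1 else 0) \<psi> x = \<psi> x"
proof -
  have "local_op d i (\<lambda>a b. if a = b then 1 else 0) \<psi> x =
      (\<Sum>a<d i. if a = x i then \<psi> (x(i := a)) else 0)"
    unfolding local_op_def by (rule sum.cong) auto
  then show ?thesis using basis_idx_less[OF assms] by (simp add: sum.delta)
qed

text \<open>The left side is the expectation of the adjoint of \<open>E\<close> on party
  \<open>i\<close> tensored with \<open>F\<close> on party \<open>j\<close>. Against a marginal
  \<open>c\<close> times the identity this is \<open>c\<close> times the trace of the tensor
  product, which factorises.\<close>

lemma expectation_local_pair:
  assumes ij: "i \<in> {1..n}" "j \<in> {1..n}" "i \<noteq> j"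
    and mixed: "\<And>x y. x \<in> basis_idx d {i, j} \<Longrightarrow> y \<in> basis_idx d {i, j} \<Longrightarrow>
      marginal n d \<psi> {i, j} x y = (if x = y then c else 0)"
  shows "(\<Sum>x\<in>basis_idx d {1..n}. cnj (local_op d i E \<psi> x) * local_op d j F \<psi> x) =
    c * cnj (\<Sum>a<d i. E a a) * (\<Sum>b<d j. F b b)"
proof -
  have "(\<Sum>x\<in>basis_idx d {1..n}. cnj (local_op d i E \<psi> x) * local_op d j F \<psi> x) =
     (\<Sum>a<d i. \<Sum>b<d j. \<Sum>x\<in>basis_idx d {1..n}.
        (cnj (E (x i) a) * F (x j) b) * (\<psi> (x(j := b)) * cnj (\<psi> (x(i := a)))))"
    unfolding local_op_inner by (subst sum.swap, rule sum.cong[OF refl], rule sum.swap)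
  also have "\<dots> = (\<Sum>a<d i. \<Sum>b<d j. c * (\<Sum>y\<in>basis_idx d {i, j}.
      if y(j := b) = y(i := a) then cnj (E (y i) a) * F (y j) b else 0))"
    by (intro sum.cong refl marginal_expectation) (use ij in \<open>auto simp: mixed\<close>)
  also have "\<dots> = c * (\<Sum>y\<in>basis_idx d {i, j}. \<Sum>a<d i. \<Sum>b<d j.
      if y(j := b) = y(i := a) then cnj (E (y i) a) * F (y j) b else 0)"
    unfolding sum_distrib_left[symmetric]
    by (subst sum.swap[of _ "basis_idx d {i, j}"], subst sum.swap[of _ "basis_idx d {i, j}"]) simp
  also have "\<dots> = c * (\<Sum>y\<in>basis_idx d {i, j}. cnj (E (y i) (y i)) * F (y j) (y j))"
  proof (intro arg_cong[where f = "(*) c"] sum.cong refl)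
    fix y assume y: "y \<in> basis_idx d {i, j}"
    \<comment> \<open>As \<open>i\<close> and \<open>j\<close> differ, comparing the two updates at
      \<open>j\<close> fixes \<open>b\<close> and comparing them at \<open>i\<close> fixes
      \<open>a\<close>, so only diagonal entries survive.\<close>
    have "y(j := b) = y(i := a) \<longleftrightarrow> b = y j \<and> a = y i" for a b
      using ij(3) by (auto simp: fun_eq_iff)
    then have "(\<Sum>a<d i. \<Sum>b<d j. if y(j := b) = y(i := a) then cnj (E (y i) a) * F (y j) b else 0) =
      (\<Sum>a<d i. if a = y i then (\<Sum>b<d j. if b = y j then cnj (E (y i) a) * F (y j) b else 0) else 0)"
      by (intro sum.cong) auto
    also have "\<dots> = cnj (E (y i) (y i)) * F (y j) (y j)"
      using basis_idx_less[OF y] by (simp add: sum.delta)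
    finally show "(\<Sum>a<d i. \<Sum>b<d j. if y(j := b) = y(i := a) then cnj (E (y i) a) * F (y j) b else 0) =
      cnj (E (y i) (y i)) * F (y j) (y j)" .
  qed
  also have "\<dots> = c * (\<Sum>p<d i. \<Sum>q<d j. cnj (E p p) * F q q)"
    using sum_basis_pair[OF ij(3), of "\<lambda>p q. cnj (E p p) * F q q" d] by simp
  finally show ?thesis by (simp add: sum_product mult.assoc)
qed

text \<open>Both operators act on party \<open>i\<close>, and party \<open>j\<close> only completes
  the pair whose marginal is known. The identity on \<open>j\<close> contributes its trace
  \<open>d j\<close>; the rest is the Hilbert-Schmidt inner product of \<open>E\<close> and
  \<open>F\<close>.\<close>

lemma expectation_local_square:
  assumes ij: "i \<in> {1..n}" "j \<in> {1..n}" "i \<noteq> j"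
    and mixed: "\<And>x y. x \<in> basis_idx d {i, j} \<Longrightarrow> y \<in> basis_idx d {i, j} \<Longrightarrow>
      marginal n d \<psi> {i, j} x y = (if x = y then c else 0)"
  shows "(\<Sum>x\<in>basis_idx d {1..n}. cnj (local_op d i E \<psi> x) * local_op d i F \<psi> x) =
    c * of_nat (d j) * (\<Sum>a<d i. \<Sum>b<d i. cnj (E a b) * F a b)"
proof -
  have "(\<Sum>x\<in>basis_idx d {1..n}. cnj (local_op d i E \<psi> x) * local_op d i F \<psi> x) =
     (\<Sum>a<d i. \<Sum>b<d i. \<Sum>x\<in>basis_idx d {1..n}.
        (cnj (E (x i) a) * F (x i) b) * (\<psi> (x(i := b)) * cnj (\<psi> (x(i := a)))))"
    unfolding local_op_inner by (subst sum.swap, rule sum.cong[OF refl], rule sum.swap)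
  also have "\<dots> = (\<Sum>a<d i. \<Sum>b<d i. c * (\<Sum>y\<in>basis_idx d {i, j}.
      if y(i := b) = y(i := a) then cnj (E (y i) a) * F (y i) b else 0))"
    by (intro sum.cong refl marginal_expectation) (use ij in \<open>auto simp: mixed\<close>)
  also have "\<dots> = c * (\<Sum>y\<in>basis_idx d {i, j}. \<Sum>a<d i. \<Sum>b<d i.
      if y(i := b) = y(i := a) then cnj (E (y i) a) * F (y i) b else 0)"
    unfolding sum_distrib_left[symmetric]
    by (subst sum.swap[of _ "basis_idx d {i, j}"], subst sum.swap[of _ "basis_idx d {i, j}"]) simp
  also have "\<dots> = c * (\<Sum>y\<in>basis_idx d {i, j}. \<Sum>a<d i. cnj (E (y i) a) * F (y i) a)"
  proof (intro arg_cong[where f = "(*) c"] sum.cong refl)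
    fix y a assume a: "a \<in> {..<d i}"
    have "y(i := b) = y(i := a) \<longleftrightarrow> b = a" for b
      by (auto simp: fun_eq_iff)
    then show "(\<Sum>b<d i. if y(i := b) = y(i := a) then cnj (E (y i) a) * F (y i) b else 0) =
      cnj (E (y i) a) * F (y i) a"
      using a by (simp add: sum.delta)
  qed
  also have "\<dots> = c * (\<Sum>p<d i. \<Sum>q<d j. \<Sum>a<d i. cnj (E p a) * F p a)"
    using sum_basis_pair[OF ij(3), of "\<lambda>p q. \<Sum>a<d i. cnj (E p a) * F p a" d] by simp
  finally show ?thesis by (simp add: sum_distrib_left mult.assoc)
qed

subsection \<open>First-order expansion of a tensor product\<close>

text \<open>Expand the product over subsets \<open>X\<close> of \<open>A\<close>, taking
  \<open>g\<close> on \<open>X\<close> and \<open>f\<close> elsewhere. Subsets with at least two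
  elements contribute at most \<open>e\<^sup>2\<close> each because \<open>e \<le> 1\<close>, and
  there are at most \<open>2 ^ card A\<close> of them.\<close>

lemma prod_first_order:
  fixes f g :: "'a \<Rightarrow> complex"
  assumes "finite A" and f: "\<And>i. i \<in> A \<Longrightarrow> cmod (f i) \<le> 1"
    and g: "\<And>i. i \<in> A \<Longrightarrow> cmod (g i) \<le> e" and e: "0 \<le> e" "e \<le> 1"
  shows "cmod ((\<Prod>i\<in>A. f i + g i) - (\<Prod>i\<in>A. f i) - (\<Sum>i\<in>A. g i * (\<Prod>j\<in>A - {i}. f j)))
    \<le> 2 ^ card A * e\<^sup>2"
proof -
  let ?t = "\<lambda>X. (\<Prod>i\<in>X. g i) * (\<Prod>i\<in>A - X. f i)"
  \<comment> \<open>The empty set and the singletons index the terms of order zero and one.\<close>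
  let ?P = "insert {} ((\<lambda>i. {i}) ` A)"
  have sub: "?P \<subseteq> Pow A" by auto
  have "(\<Prod>i\<in>A. f i + g i) = (\<Sum>X\<in>Pow A. ?t X)"
    using prod_add[OF \<open>finite A\<close>, of g f] by (simp add: add.commute)
  also have "\<dots> = (\<Sum>X\<in>Pow A - ?P. ?t X) + (\<Sum>X\<in>?P. ?t X)"
    using \<open>finite A\<close> by (intro sum.subset_diff[OF sub]) auto
  also have "(\<Sum>X\<in>?P. ?t X) = (\<Prod>i\<in>A. f i) + (\<Sum>i\<in>A. g i * (\<Prod>j\<in>A - {i}. f j))"
    using \<open>finite A\<close> by (subst sum.insert) (auto simp: sum.reindex inj_on_def)
  finally have eq: "(\<Prod>i\<in>A. f i + g i) - (\<Prod>i\<in>A. f i) - (\<Sum>i\<in>A. g i * (\<Prod>j\<in>A - {i}. f j)) =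
    (\<Sum>X\<in>Pow A - ?P. ?t X)" by simp
  have "cmod (?t X) \<le> e\<^sup>2" if X: "X \<in> Pow A - ?P" for X
  proof -
    have fin: "finite X" using X \<open>finite A\<close> finite_subset by auto
    have "card X \<noteq> 0" using X fin by auto
    moreover have "card X \<noteq> 1" using X by (auto elim!: card_1_singletonE)
    ultimately have "2 \<le> card X" by linarith
    have "cmod (\<Prod>i\<in>X. g i) \<le> (\<Prod>i\<in>X. e)"
      unfolding prod_norm[symmetric] using X g by (intro prod_mono) auto
    also have "\<dots> \<le> e\<^sup>2" using \<open>2 \<le> card X\<close> e by (simp add: power_decreasing)
    finally have 1: "cmod (\<Prod>i\<in>X. g i) \<le> e\<^sup>2" .
    have "cmod (\<Prod>i\<in>A - X. f i) \<le> 1"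
      unfolding prod_norm[symmetric] using f by (intro prod_le_1) auto
    then show ?thesis
      using mult_mono[OF 1, of "cmod (\<Prod>i\<in>A - X. f i)" 1] by (simp add: norm_mult)
  qed
  then have "cmod (\<Sum>X\<in>Pow A - ?P. ?t X) \<le> of_nat (card (Pow A - ?P)) * e\<^sup>2"
    by (rule sum_norm_bound)
  also have "\<dots> \<le> of_nat (card (Pow A)) * e\<^sup>2"
    using \<open>finite A\<close> by (intro mult_right_mono) (auto intro!: card_mono)
  also have "\<dots> = 2 ^ card A * e\<^sup>2" using \<open>finite A\<close> by (simp add: card_Pow)
  finally show ?thesis using eq by simp
qed

text \<open>The product of Kronecker deltas vanishes unless \<open>y\<close> agrees with
  \<open>x\<close> away from \<open>i\<close>, so the sum runs over the values
  \<open>x(i := a)\<close> only.\<close>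

lemma sum_local_op:
  assumes x: "x \<in> basis_idx d {1..n}" and i: "i \<in> {1..n}"
  shows "(\<Sum>y\<in>basis_idx d {1..n}. F (x i) (y i) *
      (\<Prod>j\<in>{1..n} - {i}. if x j = y j then 1 else 0) * \<psi> y) = local_op d i F \<psi> x"
proof -
  let ?Y = "(\<lambda>a. x(i := a)) ` {..<d i}"
  have sub: "?Y \<subseteq> basis_idx d {1..n}" using basis_idx_upd[OF x i] by auto
  have out: "(\<Prod>j\<in>{1..n} - {i}. if x j = y j then 1 else 0) = (0::complex)"
    if y: "y \<in> basis_idx d {1..n} - ?Y" for y
  proof (rule ccontr)
    assume "(\<Prod>j\<in>{1..n} - {i}. if x j = y j then 1 else 0) \<noteq> (0::complex)"
    then have eq: "x j = y j" if "j \<in> {1..n} - {i}" for j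
      using that by (metis (mono_tags, lifting) finite_Diff finite_atLeastAtMost prod_zero_iff)
    have "y = x(i := y i)"
      using y i eq basis_idx_upd[OF x i] basis_idx_less[of y d "{1..n}" i]
      by (intro basis_idx_eqI[of y d "{1..n}"]) auto
    then show False using y i basis_idx_less[of y d "{1..n}" i] by blast
  qed
  have "(\<Sum>y\<in>basis_idx d {1..n}. F (x i) (y i) *
      (\<Prod>j\<in>{1..n} - {i}. if x j = y j then 1 else 0) * \<psi> y) =
    (\<Sum>y\<in>?Y. F (x i) (y i) * (\<Prod>j\<in>{1..n} - {i}. if x j = y j then 1 else 0) * \<psi> y)"
    using sub out by (intro sum.mono_neutral_right) auto
  also have "\<dots> = (\<Sum>a<d i. F (x i) a * (\<Prod>j\<in>{1..n} - {i}. if x j = (x(i := a)) j then 1 else 0)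
      * \<psi> (x(i := a)))"
  proof -
    have "inj_on (\<lambda>a. x(i := a)) {..<d i}" by (auto simp: inj_on_def fun_eq_iff)
    then show ?thesis by (subst sum.reindex) auto
  qed
  also have "\<dots> = local_op d i F \<psi> x"
    unfolding local_op_def by (intro sum.cong refl) (simp add: prod.neutral)
  finally show ?thesis .
qed

subsection \<open>Invariance near the identity\<close>

locale two_uniform_state =
  fixes n :: nat and d :: "nat \<Rightarrow> nat" and \<psi> :: ket
  assumes n2: "n \<ge> 2" and state: "is_state n d \<psi>" and uniform: "k_uniform n d 2 \<psi>"
begin

abbreviation B :: "(nat \<Rightarrow> nat) set" where "B \<equiv> basis_idx d {1..n}"

lemma B_nonempty: "\<exists>x\<in>B. \<psi> x \<noteq> 0"
proof (rule ccontr)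
  assume "\<not> ?thesis"
  then have "(\<Sum>x\<in>B. (cmod (\<psi> x))\<^sup>2) = 0" by (intro sum.neutral) auto
  then show False using state unfolding is_state_def by simp
qed

lemma dim_pos: "i \<in> {1..n} \<Longrightarrow> 0 < d i"
  using B_nonempty basis_idx_less by fastforce

lemma inner_self: "(\<Sum>x\<in>B. cnj (\<psi> x) * \<psi> x) = 1"
proof -
  have "(\<Sum>x\<in>B. cnj (\<psi> x) * \<psi> x) = of_real (\<Sum>x\<in>B. (cmod (\<psi> x))\<^sup>2)"
    by (simp add: complex_norm_square mult.commute del: of_real_power)
  then show ?thesis using state unfolding is_state_def by simp
qed

text \<open>The constant is fixed by normalisation: with the identity as operator on both parties,
  the pair formula computes the squared norm of \<open>\<psi>\<close>.\<close>

lemma pair_marginal: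
  assumes ij: "i \<in> {1..n}" "j \<in> {1..n}" "i \<noteq> j"
  obtains c where "\<And>x y. x \<in> basis_idx d {i, j} \<Longrightarrow> y \<in> basis_idx d {i, j} \<Longrightarrow>
      marginal n d \<psi> {i, j} x y = (if x = y then c else 0)"
    and "c * of_nat (d i) * of_nat (d j) = 1"
proof -
  have "maximally_mixed d {i, j} (marginal n d \<psi> {i, j})"
    using uniform ij unfolding k_uniform_def by auto
  then obtain c where c: "\<And>x y. x \<in> basis_idx d {i, j} \<Longrightarrow> y \<in> basis_idx d {i, j} \<Longrightarrow>
      marginal n d \<psi> {i, j} x y = (if x = y then c else 0)"
    unfolding maximally_mixed_def by blast
  let ?I = "\<lambda>a b. if a = b then 1 else (0::complex)"
  have "(\<Sum>x\<in>B. cnj (local_op d i ?I \<psi> x) * local_op d j ?I \<psi> x) = (\<Sum>x\<in>B. cnj (\<psi> x) * \<psi> x)"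
    by (rule sum.cong[OF refl]) (use ij in \<open>simp only: local_op_id\<close>)
  moreover have "(\<Sum>x\<in>B. cnj (local_op d i ?I \<psi> x) * local_op d j ?I \<psi> x) =
      c * of_nat (d i) * of_nat (d j)"
    using expectation_local_pair[OF ij c, of ?I ?I] by simp
  ultimately have "c * of_nat (d i) * of_nat (d j) = 1" using inner_self by simp
  with c show thesis by (rule that)
qed

text \<open>Two-uniformity speaks about pairs, so a statement about a single party has to borrow a
  second one.\<close>

lemma other_party:
  assumes "i \<in> {1..n}"
  obtains j where "j \<in> {1..n}" "i \<noteq> j"
proof -
  have "(if i = 1 then 2 else 1) \<in> {1..n}" "i \<noteq> (if i = 1 then 2 else 1)" using n2 by auto
  then show thesis by (rule that)
qed

section \<open>Orthogonality of traceless local perturbations\<close>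

definition traceless :: "(nat \<Rightarrow> nat \<Rightarrow> nat \<Rightarrow> complex) \<Rightarrow> bool" where
  "traceless F \<longleftrightarrow> (\<forall>i\<in>{1..n}. (\<Sum>a<d i. F i a a) = 0)"

text \<open>Writing the left factor \<open>\<psi>\<close> as the identity on another party
  \<open>j\<close> applied to \<open>\<psi>\<close> makes the pair formula applicable; it yields a
  multiple of the trace of \<open>F i\<close>.\<close>

lemma inner_state_local:
  assumes "traceless F" "i \<in> {1..n}"
  shows "(\<Sum>x\<in>B. cnj (\<psi> x) * local_op d i (F i) \<psi> x) = 0"
proof -
  obtain j where j: "j \<in> {1..n}" "j \<noteq> i" using other_party[OF assms(2)] by metis
  obtain c where c: "\<And>x y. x \<in> basis_idx d {j, i} \<Longrightarrow> y \<in> basis_idx d {j, i} \<Longrightarrow>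
      marginal n d \<psi> {j, i} x y = (if x = y then c else 0)"
    using pair_marginal[OF j(1) assms(2) j(2)] by metis
  let ?I = "\<lambda>a b. if a = b then 1 else (0::complex)"
  have "(\<Sum>x\<in>B. cnj (\<psi> x) * local_op d i (F i) \<psi> x) =
      (\<Sum>x\<in>B. cnj (local_op d j ?I \<psi> x) * local_op d i (F i) \<psi> x)"
    by (rule sum.cong[OF refl]) (use j in \<open>simp only: local_op_id\<close>)
  also have "\<dots> = 0"
    using expectation_local_pair[OF j(1) assms(2) j(2) c, of ?I "F i"] assms
    unfolding traceless_def by simp
  finally show ?thesis .
qed

text \<open>For distinct parties the traces kill the inner product. For equal parties the
  normalisation gives \<open>c * d k = 1 / d i\<close>, where \<open>k\<close> is the auxiliary
  party.\<close>

lemma inner_local_local: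
  assumes F: "traceless F" and i: "i \<in> {1..n}" and j: "j \<in> {1..n}"
  shows "(\<Sum>x\<in>B. cnj (local_op d i (F i) \<psi> x) * local_op d j (F j) \<psi> x) =
    (if i = j then of_real ((\<Sum>a<d i. \<Sum>b<d i. (cmod (F i a b))\<^sup>2) / d i) else 0)"
proof (cases "i = j")
  case False
  then obtain c where "\<And>x y. x \<in> basis_idx d {i, j} \<Longrightarrow> y \<in> basis_idx d {i, j} \<Longrightarrow>
      marginal n d \<psi> {i, j} x y = (if x = y then c else 0)"
    using pair_marginal[OF i j] by metis
  from expectation_local_pair[OF i j False this, of "F i" "F j"] F i j False
  show ?thesis unfolding traceless_def by simp
next
  case True
  obtain k where k: "k \<in> {1..n}" "i \<noteq> k" using other_party[OF i] by metis
  obtain c where c: "\<And>x y. x \<in> basis_idx d {i, k} \<Longrightarrow> y \<in> basis_idx d {i, k} \<Longrightarrow>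
      marginal n d \<psi> {i, k} x y = (if x = y then c else 0)"
    and norm: "c * of_nat (d i) * of_nat (d k) = 1"
    using pair_marginal[OF i k] by metis
  have "c * of_nat (d k) = 1 / of_nat (d i)"
    using norm dim_pos[OF i] by (simp add: field_simps)
  moreover have "(\<Sum>a<d i. \<Sum>b<d i. cnj (F i a b) * F i a b) =
      of_real (\<Sum>a<d i. \<Sum>b<d i. (cmod (F i a b))\<^sup>2)"
    by (simp add: complex_norm_square mult.commute del: of_real_power)
  ultimately show ?thesis
    using expectation_local_square[OF i k c, of "F i" "F i"] True by simp
qed

text \<open>Pythagoras for the pairwise orthogonal vectors \<open>F\<^sub>i \<psi>\<close>.\<close>

lemma norm_sum_local:
  assumes F: "traceless F"
  shows "(\<Sum>x\<in>B. (cmod (\<Sum>i\<in>{1..n}. local_op d i (F i) \<psi> x))\<^sup>2) =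
    (\<Sum>i\<in>{1..n}. (\<Sum>a<d i. \<Sum>b<d i. (cmod (F i a b))\<^sup>2) / d i)"
proof -
  have "complex_of_real (\<Sum>x\<in>B. (cmod (\<Sum>i\<in>{1..n}. local_op d i (F i) \<psi> x))\<^sup>2) =
    (\<Sum>x\<in>B. cnj (\<Sum>i\<in>{1..n}. local_op d i (F i) \<psi> x) * (\<Sum>j\<in>{1..n}. local_op d j (F j) \<psi> x))"
    by (simp add: complex_norm_square mult.commute del: of_real_power)
  also have "\<dots> = (\<Sum>x\<in>B. \<Sum>i\<in>{1..n}. \<Sum>j\<in>{1..n}.
      cnj (local_op d i (F i) \<psi> x) * local_op d j (F j) \<psi> x)"
    by (simp add: sum_product)
  also have "\<dots> = (\<Sum>i\<in>{1..n}. \<Sum>j\<in>{1..n}. \<Sum>x\<in>B.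
      cnj (local_op d i (F i) \<psi> x) * local_op d j (F j) \<psi> x)"
    by (subst sum.swap, rule sum.cong[OF refl], rule sum.swap)
  also have "\<dots> = (\<Sum>i\<in>{1..n}. \<Sum>j\<in>{1..n}.
      if i = j then of_real ((\<Sum>a<d i. \<Sum>b<d i. (cmod (F i a b))\<^sup>2) / d i) else 0)"
    by (intro sum.cong refl inner_local_local[OF F])
  also have "\<dots> = of_real (\<Sum>i\<in>{1..n}. (\<Sum>a<d i. \<Sum>b<d i. (cmod (F i a b))\<^sup>2) / d i)"
    by (simp add: sum.delta')
  finally show ?thesis using of_real_eq_iff by blast
qed

section \<open>The vector \<open>\<Otimes>\<^sub>i (1 + F\<^sub>i) \<psi>\<close> and its expansion
  in \<open>F\<close>\<close>

definition perturbed :: "(nat \<Rightarrow> nat \<Rightarrow> nat \<Rightarrow> complex) \<Rightarrow> ket" where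
  "perturbed F x = (\<Sum>y\<in>B. (\<Prod>i\<in>{1..n}. (if x i = y i then 1 else 0) + F i (x i) (y i)) * \<psi> y)"

text \<open>Each matrix entry of the tensor product is expanded to first order. Order zero
  reproduces \<open>\<psi>\<close>, order one is the sum of the local operators, and the remainders
  are summed with weights \<open>cmod (\<psi> y)\<close>. The resulting constant does not depend on
  \<open>F\<close>.\<close>

lemma perturbed_first_order:
  assumes F: "\<And>i a b. i \<in> {1..n} \<Longrightarrow> a < d i \<Longrightarrow> b < d i \<Longrightarrow> cmod (F i a b) \<le> e"
    and e: "0 \<le> e" "e \<le> 1" and x: "x \<in> B"
  shows "cmod (perturbed F x - \<psi> x - (\<Sum>i\<in>{1..n}. local_op d i (F i) \<psi> x))
    \<le> (\<Sum>y\<in>B. 2 ^ n * cmod (\<psi> y)) * e\<^sup>2"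
proof -
  let ?\<delta> = "\<lambda>y i. if x i = y i then 1 else (0::complex)"
  let ?g = "\<lambda>y i. F i (x i) (y i)"
  let ?E = "\<lambda>y. (\<Prod>i\<in>{1..n}. ?\<delta> y i + ?g y i) - (\<Prod>i\<in>{1..n}. ?\<delta> y i) -
    (\<Sum>i\<in>{1..n}. ?g y i * (\<Prod>j\<in>{1..n} - {i}. ?\<delta> y j))"
  have "(\<Sum>y\<in>B. (\<Prod>i\<in>{1..n}. ?\<delta> y i) * \<psi> y) = (\<Sum>y\<in>B. if x = y then \<psi> y else 0)"
  proof (rule sum.cong[OF refl])
    fix y assume y: "y \<in> B"
    show "(\<Prod>i\<in>{1..n}. ?\<delta> y i) * \<psi> y = (if x = y then \<psi> y else 0)"
    proof (cases "x = y")
      case False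
      then obtain i where "i \<in> {1..n}" "x i \<noteq> y i" using basis_idx_eqI[OF x y] by blast
      then have "(\<Prod>i\<in>{1..n}. ?\<delta> y i) = 0" by (intro prod_zero) auto
      with False show ?thesis by simp
    qed simp
  qed
  then have 0: "(\<Sum>y\<in>B. (\<Prod>i\<in>{1..n}. ?\<delta> y i) * \<psi> y) = \<psi> x" using x by simp
  have "(\<Sum>y\<in>B. (\<Sum>i\<in>{1..n}. ?g y i * (\<Prod>j\<in>{1..n} - {i}. ?\<delta> y j)) * \<psi> y) =
    (\<Sum>i\<in>{1..n}. \<Sum>y\<in>B. ?g y i * (\<Prod>j\<in>{1..n} - {i}. ?\<delta> y j) * \<psi> y)"
    unfolding sum_distrib_right by (rule sum.swap)
  also have "\<dots> = (\<Sum>i\<in>{1..n}. local_op d i (F i) \<psi> x)"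
  proof (rule sum.cong[OF refl])
    fix i assume "i \<in> {1..n}"
    from sum_local_op[OF x this, of "F i" \<psi>]
    show "(\<Sum>y\<in>B. ?g y i * (\<Prod>j\<in>{1..n} - {i}. ?\<delta> y j) * \<psi> y) = local_op d i (F i) \<psi> x" .
  qed
  finally have 1: "(\<Sum>y\<in>B. (\<Sum>i\<in>{1..n}. ?g y i * (\<Prod>j\<in>{1..n} - {i}. ?\<delta> y j)) * \<psi> y) =
    (\<Sum>i\<in>{1..n}. local_op d i (F i) \<psi> x)" .
  have eq: "perturbed F x - \<psi> x - (\<Sum>i\<in>{1..n}. local_op d i (F i) \<psi> x) = (\<Sum>y\<in>B. ?E y * \<psi> y)"
    by (simp only: left_diff_distrib sum_subtractf 0 1 perturbed_def)
  show ?thesis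
    unfolding eq sum_distrib_right
  proof (rule sum_norm_le)
    fix y assume y: "y \<in> B"
    have "cmod (?E y * \<psi> y) = cmod (?E y) * cmod (\<psi> y)" by (rule norm_mult)
    also have "\<dots> \<le> (2 ^ card {1..n} * e\<^sup>2) * cmod (\<psi> y)"
    proof (rule mult_right_mono[OF _ norm_ge_zero], rule prod_first_order)
      fix i assume "i \<in> {1..n}"
      then show "cmod (?g y i) \<le> e"
        using F basis_idx_less[OF x] basis_idx_less[OF y] by blast
    qed (use e in auto)
    also have "\<dots> = 2 ^ n * cmod (\<psi> y) * e\<^sup>2" by simp
    finally show "cmod (?E y * \<psi> y) \<le> 2 ^ n * cmod (\<psi> y) * e\<^sup>2" .
  qed
qed

text \<open>If \<open>\<psi>\<close> is an eigenvector of \<open>\<Otimes>\<^sub>i (1 + F\<^sub>i)\<close> with traceless \<open>F\<^sub>i\<close>, then \<open>v = \<Sum>\<^sub>i F\<^sub>i \<psi>\<close> is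
  orthogonal to \<open>\<psi>\<close> and agrees with a multiple of \<open>\<psi>\<close> up to a second-order term \<open>u\<close>. Hence
  \<open>\<parallel>v\<parallel> \<le> \<parallel>u\<parallel>\<close>, where the left side is linear and the right side quadratic in \<open>F\<close>.\<close>

lemma small_invariant_trivial:
  "\<exists>\<epsilon>>0. \<forall>F \<mu>. traceless F \<longrightarrow>
     (\<forall>i\<in>{1..n}. \<forall>a<d i. \<forall>b<d i. cmod (F i a b) < \<epsilon>) \<longrightarrow>
     (\<forall>x\<in>B. perturbed F x = \<mu> * \<psi> x) \<longrightarrow>
     (\<forall>i\<in>{1..n}. \<forall>a<d i. \<forall>b<d i. F i a b = 0)"
proof -
  \<comment> \<open>\<open>K\<close> is the constant of the second-order remainder, \<open>L\<close>
    turns it into a bound on the squared norm of that remainder, and \<open>N\<close> dominates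
    every local dimension.\<close>
  define K where "K = (\<Sum>y\<in>B. 2 ^ n * cmod (\<psi> y))"
  define L where "L = real (card B) * K\<^sup>2"
  define N where "N = (\<Sum>i\<in>{1..n}. real (d i))"
  have NL: "0 \<le> N * L" unfolding N_def L_def by (simp add: sum_nonneg)
  \<comment> \<open>Chosen so that \<open>N * L * \<epsilon> < 1\<close>; the estimate
    \<open>e\<^sup>2 \<le> e\<^sup>2 * (N * L * e\<^sup>2)\<close> reached below then forces
    \<open>e = 0\<close>.\<close>
  define \<epsilon> where "\<epsilon> = 1 / (1 + N * L)"
  have \<epsilon>: "0 < \<epsilon>" "\<epsilon> \<le> 1" "N * L * \<epsilon> < 1" using NL unfolding \<epsilon>_def by (auto simp: field_simps)
  show ?thesis
  proof (intro exI[of _ \<epsilon>] conjI allI impI)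
    show "0 < \<epsilon>" by fact
  next
    fix F \<mu>
    assume F: "traceless F" and small: "\<forall>i\<in>{1..n}. \<forall>a<d i. \<forall>b<d i. cmod (F i a b) < \<epsilon>"
      and eig: "\<forall>x\<in>B. perturbed F x = \<mu> * \<psi> x"
    define I where "I = (SIGMA i:{1..n}. {..<d i} \<times> {..<d i})"
    define m where "m = (\<lambda>(i, a, b). cmod (F i a b))"
    \<comment> \<open>The largest entry measures the size of \<open>F\<close>: it bounds all entries
      in the remainder, and being attained it also bounds the norm of \<open>v\<close> from
      below.\<close>
    define e where "e = Max (m ` I)"
    have I: "finite I" "I \<noteq> {}"
      using dim_pos[of 1] n2 unfolding I_def by (auto simp: Sigma_empty_iff)
    have le: "cmod (F i a b) \<le> e" if "i \<in> {1..n}" "a < d i" "b < d i" for i a b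
    proof -
      have "m (i, a, b) \<le> e" unfolding e_def using I that by (intro Max_ge) (auto simp: I_def)
      then show ?thesis by (simp add: m_def)
    qed
    obtain i a b where iab: "i \<in> {1..n}" "a < d i" "b < d i" "cmod (F i a b) = e"
    proof -
      have "e \<in> m ` I" unfolding e_def using I by (intro Max_in) auto
      then show thesis using that by (auto simp: I_def m_def)
    qed
    have e: "0 \<le> e" "e < \<epsilon>" using iab small by auto
    define v where "v x = (\<Sum>i\<in>{1..n}. local_op d i (F i) \<psi> x)" for x
    define u where "u x = perturbed F x - \<psi> x - v x" for x
    have u: "cmod (u x) \<le> K * e\<^sup>2" if "x \<in> B" for x
      unfolding u_def v_def K_def using perturbed_first_order[of F e x] le e \<epsilon> that by auto
    have "(\<Sum>x\<in>B. cnj (\<psi> x) * v x) = (\<Sum>i\<in>{1..n}. \<Sum>x\<in>B. cnj (\<psi> x) * local_op d i (F i) \<psi> x)"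
      unfolding v_def sum_distrib_left by (rule sum.swap)
    also have "\<dots> = 0" by (intro sum.neutral ballI inner_state_local[OF F])
    finally have "cnj (\<Sum>x\<in>B. cnj (\<psi> x) * v x) = 0" by simp
    then have orth: "(\<Sum>x\<in>B. cnj (v x) * \<psi> x) = 0" by (simp add: mult.commute)
    have "complex_of_real (\<Sum>x\<in>B. (cmod (v x))\<^sup>2) = (\<Sum>x\<in>B. cnj (v x) * v x)"
      by (simp add: complex_norm_square mult.commute del: of_real_power)
    \<comment> \<open>The eigenvalue equation reads \<open>v = (\<mu> - 1) \<psi> - u\<close>; the
      first summand disappears by orthogonality.\<close>
    also have "\<dots> = (\<Sum>x\<in>B. (\<mu> - 1) * (cnj (v x) * \<psi> x) - cnj (v x) * u x)"
      by (rule sum.cong[OF refl]) (use eig in \<open>simp add: u_def algebra_simps\<close>)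
    also have "\<dots> = (\<mu> - 1) * (\<Sum>x\<in>B. cnj (v x) * \<psi> x) - (\<Sum>x\<in>B. cnj (v x) * u x)"
      by (simp only: sum_subtractf sum_distrib_left)
    also have "\<dots> = - (\<Sum>x\<in>B. cnj (v x) * u x)" by (simp only: orth) simp
    finally have "complex_of_real (\<Sum>x\<in>B. (cmod (v x))\<^sup>2) = - (\<Sum>x\<in>B. cnj (v x) * u x)" .
    then have "cmod (complex_of_real (\<Sum>x\<in>B. (cmod (v x))\<^sup>2)) = cmod (\<Sum>x\<in>B. cnj (v x) * u x)"
      by (simp only: norm_minus_cancel)
    then have "(\<Sum>x\<in>B. (cmod (v x))\<^sup>2) = cmod (\<Sum>x\<in>B. cnj (v x) * u x)"
      by (simp only: norm_of_real) (simp add: sum_nonneg)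
    \<comment> \<open>The arithmetic-geometric mean inequality takes the place of Cauchy-Schwarz:
      half of the squared norm of \<open>v\<close> is absorbed on the left.\<close>
    also have "\<dots> \<le> (\<Sum>x\<in>B. ((cmod (v x))\<^sup>2 + (cmod (u x))\<^sup>2) / 2)"
    proof (rule sum_norm_le)
      fix x
      show "cmod (cnj (v x) * u x) \<le> ((cmod (v x))\<^sup>2 + (cmod (u x))\<^sup>2) / 2"
        using sum_squares_bound[of "cmod (v x)" "cmod (u x)"] by (simp add: norm_mult)
    qed
    also have "\<dots> = ((\<Sum>x\<in>B. (cmod (v x))\<^sup>2) + (\<Sum>x\<in>B. (cmod (u x))\<^sup>2)) / 2"
      by (simp only: sum_divide_distrib[symmetric] sum.distrib)
    finally have "(\<Sum>x\<in>B. (cmod (v x))\<^sup>2) \<le> (\<Sum>x\<in>B. (cmod (u x))\<^sup>2)" by simp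
    also have "\<dots> \<le> (\<Sum>x\<in>B. (K * e\<^sup>2)\<^sup>2)"
      by (intro sum_mono power_mono u) auto
    also have "\<dots> = L * (e\<^sup>2 * e\<^sup>2)" by (simp add: L_def power2_eq_square mult_ac)
    finally have upper: "(\<Sum>x\<in>B. (cmod (v x))\<^sup>2) \<le> L * (e\<^sup>2 * e\<^sup>2)" .
    have Npos: "0 < real (d i)" "real (d i) \<le> N"
      using dim_pos iab(1) member_le_sum[of i "{1..n}" "\<lambda>i. real (d i)"] unfolding N_def by auto
    have "(cmod (F i a b))\<^sup>2 \<le> (\<Sum>b<d i. (cmod (F i a b))\<^sup>2)"
      by (rule member_le_sum) (use iab in auto)
    also have "\<dots> \<le> (\<Sum>a<d i. \<Sum>b<d i. (cmod (F i a b))\<^sup>2)"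
      by (rule member_le_sum[of a _ "\<lambda>a. \<Sum>b<d i. (cmod (F i a b))\<^sup>2"])
         (use iab in \<open>auto intro: sum_nonneg\<close>)
    \<comment> \<open>Lower bound: the single entry of modulus \<open>e\<close> is kept, and
      \<open>d i\<close> is replaced by the larger \<open>N\<close>.\<close>
    finally have "e\<^sup>2 / N \<le> (\<Sum>a<d i. \<Sum>b<d i. (cmod (F i a b))\<^sup>2) / d i"
      using Npos iab(4) by (intro frac_le) (simp_all add: sum_nonneg)
    also have "\<dots> \<le> (\<Sum>i\<in>{1..n}. (\<Sum>a<d i. \<Sum>b<d i. (cmod (F i a b))\<^sup>2) / d i)"
      by (rule member_le_sum[of i _ "\<lambda>i. (\<Sum>a<d i. \<Sum>b<d i. (cmod (F i a b))\<^sup>2) / d i"])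
         (use iab in \<open>auto intro!: sum_nonneg divide_nonneg_nonneg\<close>)
    also have "\<dots> = (\<Sum>x\<in>B. (cmod (v x))\<^sup>2)" unfolding v_def norm_sum_local[OF F] ..
    finally have "e\<^sup>2 / N \<le> L * (e\<^sup>2 * e\<^sup>2)" using upper by linarith
    then have bound: "e\<^sup>2 * 1 \<le> e\<^sup>2 * (N * L * e\<^sup>2)" using Npos by (simp add: field_simps)
    have "e\<^sup>2 \<le> \<epsilon>"
      using power_le_one_iff[of e 2] e \<epsilon> mult_mono[of e \<epsilon> e 1] by (simp add: power2_eq_square)
    then have "N * L * e\<^sup>2 \<le> N * L * \<epsilon>" using NL by (rule mult_left_mono)
    then have "N * L * e\<^sup>2 < 1" using \<epsilon> by simp
    then have "e\<^sup>2 = 0"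
      using bound mult_strict_left_mono[of "N * L * e\<^sup>2" 1 "e\<^sup>2"] by (cases "e\<^sup>2 = 0") auto
    then have "e = 0" by simp
    then show "\<forall>i\<in>{1..n}. \<forall>a<d i. \<forall>b<d i. F i a b = 0" using le by fastforce
  qed
qed

end

subsection \<open>One-parameter groups\<close>

lemma dim_mat_adjoint [simp]:
  "dim_row (mat_adjoint A) = dim_col A" "dim_col (mat_adjoint A) = dim_row A"
  by (simp_all add: mat_adjoint_def)

lemma index_mat_adjoint:
  fixes A :: "complex mat"
  shows "i < dim_col A \<Longrightarrow> j < dim_row A \<Longrightarrow> mat_adjoint A $$ (i, j) = cnj (A $$ (j, i))"
  by (simp add: mat_adjoint_def mat_of_rows_def)

text \<open>These are continuous homomorphisms from the circle, lifted to the real line. Periodicity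
  is built in because representations need not be unitary: compactness of the circle is what later
  puts the scalars on the unit circle.\<close>

definition one_parameter :: "nat \<Rightarrow> (real \<Rightarrow> complex mat) \<Rightarrow> bool" where
  "one_parameter m \<gamma> \<longleftrightarrow>
     (\<forall>t. \<gamma> t \<in> carrier_mat m m) \<and> \<gamma> 0 = 1\<^sub>m m \<and>
     (\<forall>s t. \<gamma> (s + t) = \<gamma> s * \<gamma> t) \<and> (\<forall>t. \<gamma> (t + 2 * pi) = \<gamma> t) \<and>
     (\<forall>a<m. \<forall>b<m. continuous_on UNIV (\<lambda>t. \<gamma> t $$ (a, b)))"

lemma one_parameterD:
  assumes "one_parameter m \<gamma>"
  shows "\<gamma> t \<in> carrier_mat m m" "\<gamma> 0 = 1\<^sub>m m" "\<gamma> (s + t) = \<gamma> s * \<gamma> t" "\<gamma> (t + 2 * pi) = \<gamma> t"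
    and "a < m \<Longrightarrow> b < m \<Longrightarrow> continuous_on UNIV (\<lambda>t. \<gamma> t $$ (a, b))"
  using assms unfolding one_parameter_def by auto

text \<open>Conjugation uses the adjoint and not the inverse, so a scalar \<open>c\<close> acts by
  \<open>c * cnj c\<close>, which is one for modulus one.\<close>

lemma scalar_adjoint_trivial:
  fixes c :: complex
  assumes "cmod c = 1" and X: "X \<in> carrier_mat m m"
  shows "(c \<cdot>\<^sub>m 1\<^sub>m m) * X * mat_adjoint (c \<cdot>\<^sub>m 1\<^sub>m m) = X"
proof -
  have adj: "mat_adjoint (c \<cdot>\<^sub>m 1\<^sub>m m) = cnj c \<cdot>\<^sub>m 1\<^sub>m m"
    by (rule eq_matI) (auto simp: index_mat_adjoint)
  have "c * cnj c = 1" using assms(1) complex_norm_square[of c] by simp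
  then have cc: "c * (y * cnj c) = y" for y
    by (metis mult.commute mult.left_commute mult_1)
  have "(c \<cdot>\<^sub>m 1\<^sub>m m) * X = c \<cdot>\<^sub>m X"
    using mult_smult_assoc_mat[of "1\<^sub>m m" m m X m c] X by simp
  moreover have "(c \<cdot>\<^sub>m X) * (cnj c \<cdot>\<^sub>m 1\<^sub>m m) = cnj c \<cdot>\<^sub>m (c \<cdot>\<^sub>m X)"
    using mult_smult_distrib[of "c \<cdot>\<^sub>m X" m m "1\<^sub>m m" m "cnj c"] X by simp
  moreover have "cnj c \<cdot>\<^sub>m (c \<cdot>\<^sub>m X) = X"
    by (rule eq_matI) (use cc in \<open>auto simp: mult_ac\<close>)
  ultimately show ?thesis unfolding adj by simp
qed

text \<open>A continuous periodic function is bounded, and \<open>f (k t)\<close> is the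
  \<open>k\<close>-th power of \<open>f t\<close>, so no value exceeds modulus one. Since
  \<open>f t * f (- t) = 1\<close>, no value falls below it either.\<close>

lemma multiplicative_periodic_norm_1:
  fixes f :: "real \<Rightarrow> complex"
  assumes add: "\<And>s t. f (s + t) = f s * f t" and zero: "f 0 = 1"
    and per: "\<And>t. f (t + p) = f t" and p: "p > 0" and cont: "continuous_on UNIV f"
  shows "cmod (f t) = 1"
proof -
  interpret periodic_fun_simple f p by unfold_locales (rule per)
  have "bounded (f ` {0..p})"
    by (intro compact_imp_bounded compact_continuous_image continuous_on_subset[OF cont]) auto
  then obtain M where M: "\<And>t. t \<in> {0..p} \<Longrightarrow> cmod (f t) \<le> M"
    unfolding bounded_iff by blast
  have all: "cmod (f t) \<le> M" for t
  proof -
    let ?k = "\<lfloor>t / p\<rfloor>"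
    have "f t = f (t - of_int ?k * p)" by (simp add: minus_of_int)
    moreover have "t - of_int ?k * p \<in> {0..p}"
      using p floor_divide_lower[OF p, of t] floor_divide_upper[OF p, of t]
      by (auto simp: algebra_simps)
    ultimately show ?thesis using M by metis
  qed
  have pow: "f (real k * t) = f t ^ k" for k t
  proof (induction k)
    case (Suc k)
    have "f (real (Suc k) * t) = f (t + real k * t)" by (simp add: algebra_simps)
    with Suc show ?case by (simp add: add)
  qed (simp add: zero)
  have le: "cmod (f t) \<le> 1" for t
  proof (rule ccontr)
    assume "\<not> cmod (f t) \<le> 1"
    then obtain k where "M < cmod (f t) ^ k" using real_arch_pow[of "cmod (f t)" M] by auto
    then show False using all[of "real k * t"] pow by (simp add: norm_power)
  qed
  have "f t * f (- t) = 1" using add[of t "- t"] zero by simp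
  then have "cmod (f t) * cmod (f (- t)) = 1" by (metis norm_mult norm_one)
  then show ?thesis
    using le[of t] le[of "- t"] mult_left_mono[OF le[of "- t"], of "cmod (f t)"] by auto
qed

text \<open>The entry at \<open>(0, 0)\<close>, which exists because \<open>0 < m\<close>, recovers
  the scalar as a continuous, multiplicative and periodic function of \<open>t\<close>.\<close>

lemma one_parameter_norm_1:
  assumes \<gamma>: "one_parameter m \<gamma>" and "0 < m" and scalar: "\<And>t. \<exists>c. \<gamma> t = c \<cdot>\<^sub>m 1\<^sub>m m"
  shows "\<exists>c. cmod c = 1 \<and> \<gamma> t = c \<cdot>\<^sub>m 1\<^sub>m m"
proof -
  define f where "f t = \<gamma> t $$ (0, 0)" for t
  have f: "\<gamma> t = f t \<cdot>\<^sub>m 1\<^sub>m m" for t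
    using scalar[of t] \<open>0 < m\<close> unfolding f_def by auto
  have "f (s + t) = f s * f t" for s t
  proof -
    have "f (s + t) = (\<gamma> s * \<gamma> t) $$ (0, 0)" by (simp add: f_def one_parameterD(3)[OF \<gamma>])
    also have "\<dots> = f s * f t"
      unfolding f[of s] f[of t]
      by (subst mult_smult_assoc_mat[of _ m m _ m]) (use \<open>0 < m\<close> in auto)
    finally show ?thesis .
  qed
  moreover have "f 0 = 1" using \<open>0 < m\<close> by (simp add: f_def one_parameterD(2)[OF \<gamma>])
  moreover have "f (t + 2 * pi) = f t" for t by (simp add: f_def one_parameterD(4)[OF \<gamma>])
  moreover have "continuous_on UNIV f"
    unfolding f_def using one_parameterD(5)[OF \<gamma>] \<open>0 < m\<close> by blast
  ultimately have "cmod (f t) = 1"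
    by (intro multiplicative_periodic_norm_1[of f "2 * pi"]) auto
  with f show ?thesis by blast
qed

text \<open>For large \<open>k\<close> the time \<open>t / k\<close> lies in the given
  neighbourhood, and \<open>\<gamma> t\<close> is the \<open>k\<close>-th power of
  \<open>\<gamma> (t / k)\<close>.\<close>

lemma one_parameter_scalar_extend:
  assumes \<gamma>: "one_parameter m \<gamma>" and "\<eta> > 0"
    and near: "\<And>t. \<bar>t\<bar> < \<eta> \<Longrightarrow> \<exists>c. \<gamma> t = c \<cdot>\<^sub>m 1\<^sub>m m"
  shows "\<exists>c. \<gamma> t = c \<cdot>\<^sub>m 1\<^sub>m m"
proof -
  obtain k where "\<bar>t\<bar> / \<eta> < real k" using reals_Archimedean2 by blast
  then have k: "\<bar>t\<bar> < real k * \<eta>" using \<open>\<eta> > 0\<close> by (simp add: pos_divide_less_eq)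
  then have k0: "0 < real k" using \<open>\<eta> > 0\<close> by (cases k) auto
  define s where "s = t / real k"
  have "\<bar>s\<bar> < \<eta>" using k k0 by (simp add: s_def field_simps)
  from near[OF this] obtain c where c: "\<gamma> s = c \<cdot>\<^sub>m 1\<^sub>m m" by blast
  have "\<gamma> (real l * s) = c ^ l \<cdot>\<^sub>m 1\<^sub>m m" for l
  proof (induction l)
    case 0
    show ?case using one_parameterD(2)[OF \<gamma>] by (auto intro!: eq_matI)
  next
    case (Suc l)
    have "\<gamma> (real (Suc l) * s) = \<gamma> s * \<gamma> (real l * s)"
      by (simp add: distrib_right one_parameterD(3)[OF \<gamma>])
    also have "\<dots> = c ^ Suc l \<cdot>\<^sub>m 1\<^sub>m m"
      unfolding Suc c by (subst mult_smult_assoc_mat[of _ m m _ m]) (auto intro!: eq_matI)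
    finally show ?case .
  qed
  from this[of k] show ?thesis using k0 by (auto simp: s_def)
qed

text \<open>Invariance says that \<open>\<psi>\<close> and its image \<open>\<phi>\<close> under
  \<open>T\<close> have the same rank-one projector. The column of that identity at a point
  \<open>z\<close> with \<open>\<psi> z \<noteq> 0\<close> shows that they are proportional.\<close>

lemma projector_invariant_eigenvector:
  assumes nonzero: "\<exists>x\<in>B. \<psi> x \<noteq> 0"
    and inv: "\<And>x y. x \<in> B \<Longrightarrow> y \<in> B \<Longrightarrow>
      op_mult B (op_mult B T (projector \<psi>)) (op_adjoint T) x y = projector \<psi> x y"
  shows "\<exists>\<mu>. \<forall>x\<in>B. (\<Sum>y\<in>B. T x y * \<psi> y) = \<mu> * \<psi> x"
proof -
  define \<phi> where "\<phi> x = (\<Sum>y\<in>B. T x y * \<psi> y)" for x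
  have "op_mult B (op_mult B T (projector \<psi>)) (op_adjoint T) x y = \<phi> x * cnj (\<phi> y)" for x y
    unfolding op_mult_def op_adjoint_def projector_def \<phi>_def
    by (simp add: sum_distrib_left sum_distrib_right mult_ac)
  then have eq: "\<phi> x * cnj (\<phi> y) = \<psi> x * cnj (\<psi> y)" if "x \<in> B" "y \<in> B" for x y
    using inv[OF that] by (simp add: projector_def)
  obtain z where z: "z \<in> B" "\<psi> z \<noteq> 0" using nonzero by blast
  then have "\<phi> z \<noteq> 0" using eq[of z z] by auto
  then have "\<phi> x = cnj (\<psi> z) / cnj (\<phi> z) * \<psi> x" if "x \<in> B" for x
    using eq[OF that z(1)] by (simp add: field_simps)
  then show ?thesis unfolding \<phi>_def by blast
qed

text \<open>By continuity, dividing each \<open>S i t\<close> by its normalised trace gives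
  \<open>1 + F\<close> with \<open>F\<close> traceless and small for small \<open>t\<close>. The
  rigidity of small invariant perturbations then yields \<open>F = 0\<close>.\<close>

lemma (in two_uniform_state) near_identity_scalar:
  assumes S: "\<And>i. i \<in> {1..n} \<Longrightarrow> one_parameter (d i) (S i)"
    and inv: "\<And>t x y. x \<in> B \<Longrightarrow> y \<in> B \<Longrightarrow>
      op_mult B (op_mult B (tensor_op n (\<lambda>i. S i t)) (projector \<psi>))
        (op_adjoint (tensor_op n (\<lambda>i. S i t))) x y = projector \<psi> x y"
  shows "\<exists>\<eta>>0. \<forall>t. \<bar>t\<bar> < \<eta> \<longrightarrow> (\<forall>i\<in>{1..n}. \<exists>c. S i t = c \<cdot>\<^sub>m 1\<^sub>m (d i))"
proof -
  obtain \<epsilon> where \<epsilon>: "\<epsilon> > 0" and small: "\<And>F \<mu> i a b. traceless F \<Longrightarrow>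
     (\<forall>i\<in>{1..n}. \<forall>a<d i. \<forall>b<d i. cmod (F i a b) < \<epsilon>) \<Longrightarrow>
     (\<forall>x\<in>B. perturbed F x = \<mu> * \<psi> x) \<Longrightarrow> i \<in> {1..n} \<Longrightarrow> a < d i \<Longrightarrow> b < d i \<Longrightarrow> F i a b = 0"
    using small_invariant_trivial by blast
  define c where "c i t = (\<Sum>a<d i. S i t $$ (a, a)) / of_nat (d i)" for i t
  define F where "F t i a b = S i t $$ (a, b) / c i t - (if a = b then 1 else 0)" for t i a b
  have S0: "((\<lambda>t. S i t $$ (a, b)) \<longlongrightarrow> (if a = b then 1 else 0)) (at 0)"
    if "i \<in> {1..n}" "a < d i" "b < d i" for i a b
  proof -
    have "((\<lambda>t. S i t $$ (a, b)) \<longlongrightarrow> S i 0 $$ (a, b)) (at 0)"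
      using one_parameterD(5)[OF S] that
      by (metis (no_types, lifting) UNIV_I continuous_on_def)
    then show ?thesis using one_parameterD(2)[OF S] that by simp
  qed
  have c0: "(c i \<longlongrightarrow> 1) (at 0)" if i: "i \<in> {1..n}" for i
  proof -
    have "((\<lambda>t. (\<Sum>a<d i. S i t $$ (a, a)) / of_nat (d i)) \<longlongrightarrow> (\<Sum>a<d i. 1) / of_nat (d i)) (at 0)"
    proof (intro tendsto_intros)
      fix a assume "a \<in> {..<d i}"
      then show "((\<lambda>t. S i t $$ (a, a)) \<longlongrightarrow> 1) (at 0)" using S0[OF i, of a a] by simp
    qed (use dim_pos[OF i] in simp)
    then show ?thesis using dim_pos[OF i] unfolding c_def by simp
  qed
  have F0: "((\<lambda>t. F t i a b) \<longlongrightarrow> 0) (at 0)" if "i \<in> {1..n}" "a < d i" "b < d i" for i a b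
  proof -
    have "((\<lambda>t. F t i a b) \<longlongrightarrow> (if a = b then 1 else 0) / 1 - (if a = b then 1 else 0)) (at 0)"
      unfolding F_def by (intro tendsto_intros S0 c0 that) simp
    then show ?thesis by simp
  qed
  \<comment> \<open>Finitely many parties and entries allow one common neighbourhood. It is
    punctured, so \<open>t = 0\<close> is treated separately below.\<close>
  have "\<forall>\<^sub>F t in at 0. \<forall>i\<in>{1..n}. c i t \<noteq> 0 \<and> (\<forall>a\<in>{..<d i}. \<forall>b\<in>{..<d i}. cmod (F t i a b) < \<epsilon>)"
  proof (intro eventually_ball_finite ballI eventually_conj finite_atLeastAtMost finite_lessThan)
    fix i assume i: "i \<in> {1..n}"
    show "\<forall>\<^sub>F t in at 0. c i t \<noteq> 0" by (rule tendsto_imp_eventually_ne[OF c0[OF i]]) simp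
    fix a b assume "a \<in> {..<d i}" "b \<in> {..<d i}"
    then show "\<forall>\<^sub>F t in at 0. cmod (F t i a b) < \<epsilon>"
      using tendstoD[OF F0[OF i, of a b] \<epsilon>] by simp
  qed
  then obtain \<eta> where "\<eta> > 0" and near: "\<And>t. t \<noteq> 0 \<Longrightarrow> \<bar>t\<bar> < \<eta> \<Longrightarrow>
      \<forall>i\<in>{1..n}. c i t \<noteq> 0 \<and> (\<forall>a\<in>{..<d i}. \<forall>b\<in>{..<d i}. cmod (F t i a b) < \<epsilon>)"
    unfolding eventually_at by (auto simp: dist_real_def)
  have "\<exists>k. S i t = k \<cdot>\<^sub>m 1\<^sub>m (d i)" if t: "\<bar>t\<bar> < \<eta>" and i: "i \<in> {1..n}" for t i
  proof (cases "t = 0")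
    case True
    have "S i t = 1 \<cdot>\<^sub>m 1\<^sub>m (d i)"
      unfolding True one_parameterD(2)[OF S[OF i]] by (rule eq_matI) auto
    then show ?thesis by blast
  next
    case False
    note near = near[OF False t]
    have tr: "traceless (F t)"
      unfolding traceless_def
    proof
      fix i assume i: "i \<in> {1..n}"
      have "(\<Sum>a<d i. F t i a a) = (\<Sum>a<d i. S i t $$ (a, a)) / c i t - of_nat (d i)"
        by (simp add: F_def sum_subtractf sum_divide_distrib)
      also have "\<dots> = 0"
        using near i dim_pos[OF i] by (auto simp: c_def field_simps)
      finally show "(\<Sum>a<d i. F t i a a) = 0" .
    qed
    obtain \<mu> where \<mu>: "\<And>x. x \<in> B \<Longrightarrow> (\<Sum>y\<in>B. tensor_op n (\<lambda>i. S i t) x y * \<psi> y) = \<mu> * \<psi> x"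
      using projector_invariant_eigenvector[OF B_nonempty inv] by metis
    \<comment> \<open>Dividing all tensor factors by their scalars only rescales the
      eigenvalue.\<close>
    have "perturbed (F t) x = \<mu> / (\<Prod>i\<in>{1..n}. c i t) * \<psi> x" if x: "x \<in> B" for x
    proof -
      have "perturbed (F t) x = (\<Sum>y\<in>B. tensor_op n (\<lambda>i. S i t) x y * \<psi> y / (\<Prod>i\<in>{1..n}. c i t))"
        unfolding perturbed_def tensor_op_def
        by (intro sum.cong refl) (simp add: F_def prod_dividef)
      then show ?thesis using \<mu>[OF x] by (simp add: sum_divide_distrib[symmetric])
    qed
    then have zero: "F t i a b = 0" if "a < d i" "b < d i" for a b
      using small[OF tr _ _ i that] near by (metis lessThan_iff)
    have "S i t = c i t \<cdot>\<^sub>m 1\<^sub>m (d i)"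
    proof (rule eq_matI)
      fix a b assume "a < dim_row (c i t \<cdot>\<^sub>m 1\<^sub>m (d i))" "b < dim_col (c i t \<cdot>\<^sub>m 1\<^sub>m (d i))"
      then have ab: "a < d i" "b < d i" by auto
      have "S i t $$ (a, b) / c i t = (if a = b then 1 else 0)"
        using zero[OF ab] by (simp add: F_def)
      then show "S i t $$ (a, b) = (c i t \<cdot>\<^sub>m 1\<^sub>m (d i)) $$ (a, b)"
        using near i ab by (auto split: if_splits)
    qed (use one_parameterD(1)[OF S[OF i], of t] in auto)
    then show ?thesis by blast
  qed
  with \<open>\<eta> > 0\<close> show ?thesis by blast
qed

text \<open>Scalarity spreads from a neighbourhood of zero to all times, and periodicity then fixes
  the modulus.\<close>

lemma (in two_uniform_state) one_parameter_scalar: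
  assumes S: "\<And>i. i \<in> {1..n} \<Longrightarrow> one_parameter (d i) (S i)"
    and inv: "\<And>t x y. x \<in> B \<Longrightarrow> y \<in> B \<Longrightarrow>
      op_mult B (op_mult B (tensor_op n (\<lambda>i. S i t)) (projector \<psi>))
        (op_adjoint (tensor_op n (\<lambda>i. S i t))) x y = projector \<psi> x y"
    and i: "i \<in> {1..n}"
  shows "\<exists>c. cmod c = 1 \<and> S i t = c \<cdot>\<^sub>m 1\<^sub>m (d i)"
proof -
  obtain \<eta> where "\<eta> > 0" and near: "\<And>t. \<bar>t\<bar> < \<eta> \<Longrightarrow> \<exists>c. S i t = c \<cdot>\<^sub>m 1\<^sub>m (d i)"
    using near_identity_scalar[OF S inv] i by blast
  have "\<exists>c. S i t = c \<cdot>\<^sub>m 1\<^sub>m (d i)" for t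
    by (rule one_parameter_scalar_extend[OF S[OF i] \<open>\<eta> > 0\<close> near])
  then show ?thesis by (rule one_parameter_norm_1[OF S[OF i] dim_pos[OF i]])
qed

subsection \<open>Matrix groups covered by one-parameter groups\<close>

lemma group_simps:
  "mult (GL_group m) = (*)" "mult (U_group m) = (*)" "mult (SU_group m) = (*)"
  "carrier (U_group m) =
     {A \<in> carrier_mat m m. A * mat_adjoint A = 1\<^sub>m m \<and> mat_adjoint A * A = 1\<^sub>m m}"
  "carrier (SU_group m) = {A \<in> carrier (U_group m). Determinant.det A = 1}"
  by (simp_all add: GL_group_def U_group_def SU_group_def units_of_def ring_mat_simps)

section \<open>Continuity of matrix entries, and representations along curves\<close>

lemma continuous_entry:
  "a < m \<Longrightarrow> b < m \<Longrightarrow> continuous_map (mat_topology m) euclidean (\<lambda>A. A $$ (a, b))"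
proof -
  assume ab: "a < m" "b < m"
  let ?f = "\<lambda>A::complex mat. \<lambda>ij\<in>{..<m} \<times> {..<m}. A $$ ij"
  have "continuous_map (mat_topology m) euclidean ((\<lambda>f. f (a, b)) \<circ> ?f)"
    unfolding mat_topology_def
    by (intro continuous_map_pullback continuous_map_product_projection) (use ab in auto)
  moreover have "(\<lambda>f. f (a, b)) \<circ> ?f = (\<lambda>A. A $$ (a, b))" using ab by auto
  ultimately show ?thesis by simp
qed

lemma continuous_map_mat_topologyI:
  assumes "\<And>t. \<gamma> t \<in> carrier_mat m m"
    and cont: "\<And>a b. a < m \<Longrightarrow> b < m \<Longrightarrow> continuous_on UNIV (\<lambda>t::real. \<gamma> t $$ (a, b))"
  shows "continuous_map euclidean (mat_topology m) \<gamma>"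
  unfolding mat_topology_def
proof (rule continuous_map_pullback')
  show "continuous_map euclidean (product_topology (\<lambda>_. euclidean) ({..<m} \<times> {..<m}))
      ((\<lambda>A. \<lambda>ij\<in>{..<m} \<times> {..<m}. A $$ ij) \<circ> \<gamma>)"
    unfolding continuous_map_componentwise using cont by auto
qed (use assms in auto)

lemma rep_one_parameter:
  assumes rep: "cont_rep m G e R" and \<gamma>: "one_parameter m \<gamma>" and G: "\<And>t. \<gamma> t \<in> carrier G"
    and mult: "mult G = (*)"
  shows "one_parameter e (\<lambda>t. R (\<gamma> t))"
proof -
  have hom: "R \<in> hom G (GL_group e)"
    and cont: "continuous_map (subtopology (mat_topology m) (carrier G)) (mat_topology e) R"
    using rep unfolding cont_rep_def by auto
  have Rmult: "R (g * h) = R g * R h" if "g \<in> carrier G" "h \<in> carrier G" for g h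
    using hom_mult[OF hom that] by (simp add: mult group_simps)
  have R: "R g \<in> Units (ring_mat TYPE(complex) e ())" if "g \<in> carrier G" for g
    using hom_in_carrier[OF hom that] by (simp add: GL_group_def units_of_def)
  have add: "R (\<gamma> (s + t)) = R (\<gamma> s) * R (\<gamma> t)" for s t
    by (simp add: one_parameterD(3)[OF \<gamma>] Rmult G)
  have car: "R (\<gamma> t) \<in> carrier_mat e e" for t
    using R[OF G, of t] by (auto simp: Units_def ring_mat_simps)
  \<comment> \<open>Membership in \<open>hom\<close> only gives multiplicativity;
    \<open>R (\<gamma> 0)\<close> is an invertible idempotent and hence the identity.\<close>
  have one: "R (\<gamma> 0) = 1\<^sub>m e"
  proof -
    obtain Y where Y: "Y \<in> carrier_mat e e" "Y * R (\<gamma> 0) = 1\<^sub>m e"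
      using R[OF G, of 0] by (auto simp: Units_def ring_mat_simps)
    have "R (\<gamma> 0) = (Y * R (\<gamma> 0)) * R (\<gamma> 0)" using car[of 0] unfolding Y by simp
    also have "\<dots> = Y * (R (\<gamma> 0) * R (\<gamma> 0))" by (rule assoc_mult_mat[OF Y(1) car car])
    also have "R (\<gamma> 0) * R (\<gamma> 0) = R (\<gamma> 0)" using add[of 0 0] by simp
    finally show ?thesis using Y by simp
  qed
  have "continuous_map euclidean (subtopology (mat_topology m) (carrier G)) \<gamma>"
    using continuous_map_mat_topologyI[OF one_parameterD(1,5)[OF \<gamma>]] G
    by (intro continuous_map_into_subtopology) auto
  then have "continuous_map euclidean (mat_topology e) (R \<circ> \<gamma>)"
    using cont by (rule continuous_map_compose)
  note Rcont = this
  have "continuous_on UNIV (\<lambda>t. R (\<gamma> t) $$ (a, b))" if "a < e" "b < e" for a b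
    using continuous_map_compose[OF Rcont continuous_entry[OF that]] by (simp add: o_def)
  then show ?thesis
    unfolding one_parameter_def using car one add one_parameterD(4)[OF \<gamma>] by simp
qed

lemma invariant_stateD:
  assumes "invariant_state n d G R \<psi>" "g \<in> carrier G"
    "x \<in> basis_idx d {1..n}" "y \<in> basis_idx d {1..n}"
  shows "op_mult (basis_idx d {1..n})
      (op_mult (basis_idx d {1..n}) (tensor_op n (\<lambda>i. R i g)) (projector \<psi>))
      (op_adjoint (tensor_op n (\<lambda>i. R i g))) x y = projector \<psi> x y"
  using assms unfolding invariant_state_def Let_def by blast

text \<open>Each group element lies on a periodic one-parameter group inside \<open>G\<close>. The
  representations carry that curve to one-parameter groups on all parties simultaneously, and these
  consist of scalars of modulus one.\<close>

lemma (in two_uniform_state) invariant_adjoint_trivial: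
  assumes rep: "\<And>i. i \<in> {1..n} \<Longrightarrow> cont_rep m G (d i) (R i)"
    and inv: "invariant_state n d G R \<psi>" and mult: "mult G = (*)"
    and cover: "\<And>g. g \<in> carrier G \<Longrightarrow> \<exists>\<gamma> t. one_parameter m \<gamma> \<and> (\<forall>s. \<gamma> s \<in> carrier G) \<and> g = \<gamma> t"
    and i: "i \<in> {1..n}"
  shows "\<not> nontrivial_adjoint G (d i) (R i)"
proof -
  have "R i g * X * mat_adjoint (R i g) = X"
    if g: "g \<in> carrier G" and X: "X \<in> carrier_mat (d i) (d i)" for g X
  proof -
    obtain \<gamma> t where \<gamma>: "one_parameter m \<gamma>" "\<And>s. \<gamma> s \<in> carrier G" "g = \<gamma> t"
      using cover[OF g] by blast
    have "\<exists>c. cmod c = 1 \<and> R i (\<gamma> t) = c \<cdot>\<^sub>m 1\<^sub>m (d i)"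
      by (rule one_parameter_scalar[where S = "\<lambda>i t. R i (\<gamma> t)"])
         (use rep_one_parameter[OF rep \<gamma>(1,2) mult] invariant_stateD[OF inv \<gamma>(2)] i in auto)
    then show ?thesis using scalar_adjoint_trivial X \<gamma>(3) by metis
  qed
  then show ?thesis unfolding nontrivial_adjoint_def by blast
qed

section \<open>The curve \<open>diag(e\<^sup>i\<^sup>t, 1, \<dots>, 1)\<close>, which sweeps out
  \<open>U(1)\<close> in dimension one\<close>

definition phase_curve :: "nat \<Rightarrow> real \<Rightarrow> complex mat" where
  "phase_curve m t = mat_diag m (\<lambda>k. if k = 0 then cis t else 1)"

lemma phase_curve_one_parameter: "one_parameter m (phase_curve m)"
  unfolding one_parameter_def
proof (intro conjI allI impI)
  fix s t :: real
  show "phase_curve m t \<in> carrier_mat m m" by (simp add: phase_curve_def)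
  have "(\<lambda>k::nat. if k = 0 then cis 0 else 1) = (\<lambda>_. 1)" by auto
  then show "phase_curve m 0 = 1\<^sub>m m" by (simp only: phase_curve_def mat_diag_one)
  show "phase_curve m (s + t) = phase_curve m s * phase_curve m t"
    unfolding phase_curve_def mat_diag_diag
    by (rule arg_cong[where f = "mat_diag m"]) (auto simp: cis_mult)
  have "cis (t + 2 * pi) = cis t" by (simp add: complex_eq_iff)
  then show "phase_curve m (t + 2 * pi) = phase_curve m t" by (simp only: phase_curve_def)
next
  fix a b assume "a < m" "b < m"
  then show "continuous_on UNIV (\<lambda>t. phase_curve m t $$ (a, b))"
    by (cases "a = b"; cases "b = 0") (auto simp: phase_curve_def mat_diag_def intro!: continuous_intros)
qed

lemma phase_curve_unitary: "phase_curve m t \<in> carrier (U_group m)"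
proof -
  have "mat_adjoint (phase_curve m t) = mat_diag m (\<lambda>k. if k = 0 then cis (- t) else 1)"
    by (rule eq_matI) (auto simp: phase_curve_def mat_diag_def index_mat_adjoint cis_cnj)
  moreover have "(\<lambda>k::nat. (if k = 0 then cis t else 1) * (if k = 0 then cis (- t) else 1)) = (\<lambda>_. 1)"
    "(\<lambda>k::nat. (if k = 0 then cis (- t) else 1) * (if k = 0 then cis t else 1)) = (\<lambda>_. 1)"
    by (auto simp: cis_mult)
  ultimately show ?thesis by (simp add: group_simps phase_curve_def)
qed

text \<open>Unitarity makes the only entry a number of modulus one; its argument is the
  parameter.\<close>

lemma U_1_phase_curve:
  assumes "g \<in> carrier (U_group 1)"
  shows "\<exists>t. g = phase_curve 1 t"
proof -
  have g: "g \<in> carrier_mat 1 1" "g * mat_adjoint g = 1\<^sub>m 1" using assms by (auto simp: group_simps)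
  define z where "z = g $$ (0, 0)"
  have "(g * mat_adjoint g) $$ (0, 0) = z * cnj z"
    using g(1) by (simp add: scalar_prod_def index_mat_adjoint z_def One_nat_def)
  then have "z * cnj z = 1" using g(2) by simp
  then have "complex_of_real ((cmod z)\<^sup>2) = 1" by (simp only: complex_norm_square)
  then have "cmod z = 1" unfolding of_real_eq_1_iff by (simp add: abs_square_eq_1)
  then have "z = cis (Arg z)" using rcis_cmod_Arg[of z] by (simp add: rcis_def)
  then have "g = phase_curve 1 (Arg z)"
    using g(1) by (intro eq_matI) (auto simp: phase_curve_def mat_diag_def z_def)
  then show ?thesis by blast
qed

section \<open>Entrywise calculus of two by two matrices\<close>

definition mat2 :: "complex \<Rightarrow> complex \<Rightarrow> complex \<Rightarrow> complex \<Rightarrow> complex mat" where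
  "mat2 a b c e = Matrix.mat 2 2 (\<lambda>(i, j).
     if i = 0 then if j = 0 then a else b else if j = 0 then c else e)"

lemma mat2_carrier [simp]:
  "mat2 a b c e \<in> carrier_mat 2 2" "dim_row (mat2 a b c e) = 2" "dim_col (mat2 a b c e) = 2"
  by (simp_all add: mat2_def)

lemma mat2_index [simp]:
  "mat2 a b c e $$ (0, 0) = a" "mat2 a b c e $$ (0, 1) = b"
  "mat2 a b c e $$ (1, 0) = c" "mat2 a b c e $$ (1, 1) = e"
  by (simp_all add: mat2_def)

lemma mat2_eqI:
  assumes "A \<in> carrier_mat 2 2" "A $$ (0, 0) = a" "A $$ (0, 1) = b" "A $$ (1, 0) = c" "A $$ (1, 1) = e"
  shows "A = mat2 a b c e"
  by (rule eq_matI) (use assms in \<open>auto simp: mat2_def less_2_cases_iff One_nat_def\<close>)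

lemma mat2_inject: "mat2 a b c e = mat2 a' b' c' e' \<longleftrightarrow> a = a' \<and> b = b' \<and> c = c' \<and> e = e'"
  by (metis mat2_index)

lemma mult_mat2_index:
  fixes A C :: "complex mat"
  assumes "A \<in> carrier_mat 2 2" "C \<in> carrier_mat 2 2" "i < 2" "j < 2"
  shows "(A * C) $$ (i, j) = A $$ (i, 0) * C $$ (0, j) + A $$ (i, 1) * C $$ (1, j)"
proof -
  have "(\<Sum>k = 0..<2. f k) = f 0 + f 1" for f :: "nat \<Rightarrow> complex"
    by (simp add: numeral_2_eq_2 One_nat_def)
  then show ?thesis using assms by (simp add: scalar_prod_def)
qed

lemma mat2_mult:
  "mat2 a b c e * mat2 a' b' c' e' =
    mat2 (a * a' + b * c') (a * b' + b * e') (c * a' + e * c') (c * b' + e * e')"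
  by (rule mat2_eqI) (auto simp: mult_mat2_index simp del: index_mult_mat intro!: mult_carrier_mat)

lemma mat2_adjoint: "mat_adjoint (mat2 a b c e) = mat2 (cnj a) (cnj c) (cnj b) (cnj e)"
  by (rule mat2_eqI) (auto simp: index_mat_adjoint)

lemma mat2_one: "1\<^sub>m 2 = mat2 1 0 0 1"
  by (rule mat2_eqI) auto

lemma mat2_det: "Determinant.det (mat2 a b c e) = a * e - b * c"
proof -
  have sum2: "(\<Sum>j<2. f j) = f 0 + f 1" for f :: "nat \<Rightarrow> complex"
    by (simp add: numeral_2_eq_2 One_nat_def)
  have "Determinant.det (mat2 a b c e) = (\<Sum>j<2. mat2 a b c e $$ (0, j) * cofactor (mat2 a b c e) 0 j)"
    by (rule laplace_expansion_row) auto
  also have "\<dots> = a * cofactor (mat2 a b c e) 0 0 + b * cofactor (mat2 a b c e) 0 1"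
    by (simp only: sum2 mat2_index)
  also have "cofactor (mat2 a b c e) 0 0 = e"
    unfolding cofactor_def by (subst det_single) (auto simp: mat_delete_def mat2_def)
  also have "cofactor (mat2 a b c e) 0 1 = - c"
    unfolding cofactor_def by (subst det_single) (auto simp: mat_delete_def mat2_def)
  finally show ?thesis by simp
qed

section \<open>Rotations covering \<open>SU(2)\<close>\<close>

lemma mult_cnj_unit_pair:
  assumes "p\<^sup>2 + (cmod q)\<^sup>2 = 1"
  shows "q * cnj q = 1 - complex_of_real p * complex_of_real p"
proof -
  have "(cmod q)\<^sup>2 = 1 - p * p" using assms by (simp add: power2_eq_square)
  then have "complex_of_real ((cmod q)\<^sup>2) = 1 - complex_of_real p * complex_of_real p" by simp
  then show ?thesis by (simp only: complex_norm_square)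
qed

text \<open>The curve \<open>exp (i t N)\<close> for the Hermitian involution \<open>N = (p, q; cnj q, -p)\<close>,
  \<open>p\<^sup>2 + \<bar>q\<bar>\<^sup>2 = 1\<close>.\<close>

definition rotation_curve :: "real \<Rightarrow> complex \<Rightarrow> real \<Rightarrow> complex mat" where
  "rotation_curve p q t = (let C = complex_of_real (cos t); S = complex_of_real (sin t)
     in mat2 (C + \<i> * S * p) (\<i> * S * q) (\<i> * S * cnj q) (C - \<i> * S * p))"

text \<open>With \<open>r\<close> standing for \<open>cnj q\<close> and \<open>I\<close> for the
  imaginary unit, the first four identities are the entries of the addition law of
  \<open>exp (i t N)\<close>, and the last is the determinant. They rest on
  \<open>I * I = -1\<close> and on \<open>q * r = 1 - p * p\<close>, which expresses that
  \<open>N\<close> squares to the identity.\<close>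

lemma rotation_identities:
  fixes I c s c' s' p q r :: complex
  assumes qr: "q * r = 1 - p * p" and I: "I * I = -1"
  shows "c * c' - s * s' + I * (s * c' + c * s') * p =
      (c + I * s * p) * (c' + I * s' * p) + I * s * q * (I * s' * r)"
    and "I * (s * c' + c * s') * q = (c + I * s * p) * (I * s' * q) + I * s * q * (c' - I * s' * p)"
    and "I * (s * c' + c * s') * r = I * s * r * (c' + I * s' * p) + (c - I * s * p) * (I * s' * r)"
    and "c * c' - s * s' - I * (s * c' + c * s') * p =
      I * s * r * (I * s' * q) + (c - I * s * p) * (c' - I * s' * p)"
    and "(c + I * s * p) * (c - I * s * p) - I * s * q * (I * s * r) = c * c + s * s"
proof -
  have "(c + I * s * p) * (c' + I * s' * p) + I * s * q * (I * s' * r) =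
      c * c' + I * (s * c' + c * s') * p + (I * I) * (s * s' * (p * p + q * r))"
    by (simp add: algebra_simps)
  then show "c * c' - s * s' + I * (s * c' + c * s') * p =
      (c + I * s * p) * (c' + I * s' * p) + I * s * q * (I * s' * r)"
    unfolding qr I by simp
  have "I * s * r * (I * s' * q) + (c - I * s * p) * (c' - I * s' * p) =
      c * c' - I * (s * c' + c * s') * p + (I * I) * (s * s' * (p * p + q * r))"
    by (simp add: algebra_simps)
  then show "c * c' - s * s' - I * (s * c' + c * s') * p =
      I * s * r * (I * s' * q) + (c - I * s * p) * (c' - I * s' * p)"
    unfolding qr I by simp
  have "(c + I * s * p) * (c - I * s * p) - I * s * q * (I * s * r) =
      c * c - (I * I) * (s * s * (p * p + q * r))"
    by (simp add: algebra_simps)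
  then show "(c + I * s * p) * (c - I * s * p) - I * s * q * (I * s * r) = c * c + s * s"
    unfolding qr I by simp
qed (simp_all add: algebra_simps)

lemma rotation_curve_one_parameter:
  assumes N: "p\<^sup>2 + (cmod q)\<^sup>2 = 1"
  shows "one_parameter 2 (rotation_curve p q)"
  unfolding one_parameter_def
proof (intro conjI allI impI)
  fix s t :: real
  note pq = mult_cnj_unit_pair[OF N]
  have C: "complex_of_real (cos (s + t)) = complex_of_real (cos s) * complex_of_real (cos t)
      - complex_of_real (sin s) * complex_of_real (sin t)"
    and S: "complex_of_real (sin (s + t)) = complex_of_real (sin s) * complex_of_real (cos t)
      + complex_of_real (cos s) * complex_of_real (sin t)"
    by (simp_all add: cos_add sin_add del: cos_of_real sin_of_real)
  show "rotation_curve p q (s + t) = rotation_curve p q s * rotation_curve p q t"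
    unfolding rotation_curve_def Let_def mat2_mult mat2_inject C S
    by (intro conjI rotation_identities[OF pq i_squared])
next
  fix a b :: nat assume "a < 2" "b < 2"
  then show "continuous_on UNIV (\<lambda>t. rotation_curve p q t $$ (a, b))"
    unfolding rotation_curve_def Let_def mat2_def
    by (cases "a = 0"; cases "b = 0") (auto intro!: continuous_intros)
qed (auto simp: rotation_curve_def Let_def mat2_one)

text \<open>As \<open>N\<close> is Hermitian, the adjoint at time \<open>t\<close> is the curve at
  time \<open>- t\<close>, so unitarity is the group law. The determinant reduces to
  \<open>cos\<^sup>2 + sin\<^sup>2\<close>.\<close>

lemma rotation_curve_SU:
  assumes N: "p\<^sup>2 + (cmod q)\<^sup>2 = 1"
  shows "rotation_curve p q t \<in> carrier (SU_group 2)"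
proof -
  note pq = mult_cnj_unit_pair[OF N]
  have "cos t * cos t = 1 - sin t * sin t" using cos_squared_eq[of t] by (simp add: power2_eq_square)
  then have sc: "complex_of_real (cos t) * complex_of_real (cos t) =
      1 - complex_of_real (sin t) * complex_of_real (sin t)"
    by (metis of_real_1 of_real_diff of_real_mult)
  have adj: "mat_adjoint (rotation_curve p q t) = rotation_curve p q (- t)"
    unfolding rotation_curve_def Let_def mat2_adjoint by simp
  have inv: "rotation_curve p q t * rotation_curve p q (- t) = 1\<^sub>m 2" for t
    using one_parameterD(2,3)[OF rotation_curve_one_parameter[OF N]] by (metis add.right_inverse)
  have "Determinant.det (rotation_curve p q t) = 1"
    unfolding rotation_curve_def Let_def mat2_det
    by (simp only: rotation_identities(5)[OF pq i_squared] sc) simp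
  moreover have "rotation_curve p q t \<in> carrier_mat 2 2" by (simp add: rotation_curve_def Let_def)
  ultimately show ?thesis using inv[of t] inv[of "- t"] by (simp add: group_simps adj)
qed

text \<open>Axis and angle: an element of \<open>SU(2)\<close> has the rows \<open>(a, b)\<close>
  and \<open>(- cnj b, cnj a)\<close>. The angle comes from \<open>cos t = Re a\<close>; the
  remaining entries divided by \<open>sin t\<close> give the axis.\<close>

lemma SU_2_rotation_curve:
  assumes "g \<in> carrier (SU_group 2)"
  shows "\<exists>p q t. p\<^sup>2 + (cmod q)\<^sup>2 = 1 \<and> g = rotation_curve p q t"
proof -
  obtain a b c e where g: "g = mat2 a b c e"
    using mat2_eqI[OF _ refl refl refl refl] assms unfolding group_simps by blast
  have "mat_adjoint g * g = 1\<^sub>m 2" "Determinant.det g = 1" using assms by (auto simp: group_simps)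
  then have eqs: "cnj a * a + cnj c * c = 1" "cnj a * b + cnj c * e = 0" "cnj b * b + cnj e * e = 1"
    "cnj b * a + cnj e * c = 0" "a * e - b * c = 1"
    unfolding g mat2_adjoint mat2_mult mat2_one mat2_inject mat2_det by auto
  \<comment> \<open>The norm of the first column and its orthogonality to the second are combined so
    that the determinant factors out.\<close>
  have "e = e * (cnj a * a + cnj c * c) - c * (cnj a * b + cnj c * e)" using eqs by simp
  also have "\<dots> = cnj a * (a * e - b * c)" by (simp add: algebra_simps)
  finally have e: "e = cnj a" using eqs by simp
  have "c = c * (cnj b * b + cnj e * e) - e * (cnj b * a + cnj e * c)" using eqs by simp
  also have "\<dots> = - cnj b * (a * e - b * c)" by (simp add: algebra_simps)
  finally have c: "c = - cnj b" using eqs by simp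
  have "complex_of_real ((cmod a)\<^sup>2 + (cmod b)\<^sup>2) = 1"
    using eqs(5) unfolding e c by (simp add: complex_norm_square del: of_real_power)
  then have ab: "(Re a)\<^sup>2 + (Im a)\<^sup>2 + (cmod b)\<^sup>2 = 1"
    unfolding cmod_power2[of a] of_real_eq_1_iff .
  define t where "t = arccos (Re a)"
  have "(Re a)\<^sup>2 \<le> 1" using ab by (smt (verit) zero_le_power2)
  then have Re: "\<bar>Re a\<bar> \<le> 1" by (simp add: abs_square_le_1)
  then have cos: "cos t = Re a" unfolding t_def by (simp add: cos_arccos_abs)
  have sin: "(sin t)\<^sup>2 = (Im a)\<^sup>2 + (cmod b)\<^sup>2"
    using ab unfolding sin_squared_eq cos by simp
  show ?thesis
  proof (cases "sin t = 0")
    case True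
    then have "Im a = 0" "b = 0" using sin by (auto simp: add_nonneg_eq_0_iff)
    \<comment> \<open>Here \<open>g\<close> is the identity or its negative and every axis would do;
      the diagonal one is taken.\<close>
    then have "g = rotation_curve 1 0 t"
      unfolding g e c rotation_curve_def Let_def mat2_inject using True cos by (auto simp: complex_eq_iff)
    moreover have "(1::real)\<^sup>2 + (cmod 0)\<^sup>2 = 1" by simp
    ultimately show ?thesis by blast
  next
    case False
    \<comment> \<open>The axis is read off from \<open>sin t * p = Im a\<close> and
      \<open>\<i> * sin t * q = b\<close>.\<close>
    define p where "p = Im a / sin t"
    define q where "q = - \<i> * b / complex_of_real (sin t)"
    have "p\<^sup>2 + (cmod q)\<^sup>2 = ((Im a)\<^sup>2 + (cmod b)\<^sup>2) / (sin t)\<^sup>2"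
      by (simp add: p_def q_def norm_mult norm_divide power_divide add_divide_distrib)
    also have "\<dots> = 1" unfolding sin[symmetric] using False by simp
    finally have pq: "p\<^sup>2 + (cmod q)\<^sup>2 = 1" .
    have "\<i> * complex_of_real (sin t) * q = b" "\<i> * complex_of_real (sin t) * cnj q = - cnj b"
      "complex_of_real (sin t) * complex_of_real p = complex_of_real (Im a)"
      using False by (simp_all add: p_def q_def)
    then have "g = rotation_curve p q t"
      unfolding g e c rotation_curve_def Let_def mat2_inject using cos
      by (simp add: complex_eq_iff mult.assoc)
    with pq show ?thesis by blast
  qed
qed

lemma U_1_covered:
  "g \<in> carrier (U_group 1) \<Longrightarrow>
    \<exists>\<gamma> t. one_parameter 1 \<gamma> \<and> (\<forall>s. \<gamma> s \<in> carrier (U_group 1)) \<and> g = \<gamma> t"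
  using U_1_phase_curve phase_curve_one_parameter phase_curve_unitary by blast

lemma SU_2_covered:
  "g \<in> carrier (SU_group 2) \<Longrightarrow>
    \<exists>\<gamma> t. one_parameter 2 \<gamma> \<and> (\<forall>s. \<gamma> s \<in> carrier (SU_group 2)) \<and> g = \<gamma> t"
  using SU_2_rotation_curve rotation_curve_one_parameter rotation_curve_SU by blast

text \<open>A single curve suffices here: its scalarity forces \<open>D = 1\<close>, and in
  dimension one the same curve reaches every group element.\<close>

lemma (in two_uniform_state) fundamental_adjoint_trivial:
  assumes dims: "\<And>i. i \<in> {1..n} \<Longrightarrow> d i = D"
    and inv: "invariant_state n d (U_group D) (\<lambda>i g. g) \<psi>" and i: "i \<in> {1..n}"
  shows "\<not> nontrivial_adjoint (U_group D) (d i) (\<lambda>g. g)"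
proof -
  have scalar: "\<exists>c. cmod c = 1 \<and> phase_curve D t = c \<cdot>\<^sub>m 1\<^sub>m (d i)" for t
    by (rule one_parameter_scalar[where S = "\<lambda>i. phase_curve D"])
       (use dims phase_curve_one_parameter invariant_stateD[OF inv phase_curve_unitary] i in auto)
  have D: "D = 1"
  proof (rule ccontr)
    assume "D \<noteq> 1"
    then have D: "1 < D" using dim_pos[OF i] dims[OF i] by simp
    obtain c where "phase_curve D pi = c \<cdot>\<^sub>m 1\<^sub>m D" using scalar dims[OF i] by auto
    \<comment> \<open>At \<open>t = pi\<close> these two entries are \<open>-1\<close> and
      \<open>1\<close>.\<close>
    then have "phase_curve D pi $$ (0, 0) = phase_curve D pi $$ (1, 1)" using D by simp
    then show False using D by (simp add: phase_curve_def mat_diag_def)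
  qed
  have "g * X * mat_adjoint g = X" if "g \<in> carrier (U_group D)" "X \<in> carrier_mat (d i) (d i)" for g X
    using U_1_phase_curve[of g] scalar scalar_adjoint_trivial that unfolding D by metis
  then show ?thesis unfolding nontrivial_adjoint_def by blast
qed

theorem mainTheorem2:
  fixes n :: nat and d :: "nat \<Rightarrow> nat" and \<psi> :: ket
  assumes "n \<ge> 2" and "is_state n d \<psi>"
  shows
    "(\<forall>R. (\<forall>i\<in>{1..n}. cont_rep 1 (U_group 1) (d i) (R i)) \<and>
          (\<exists>i\<in>{1..n}. nontrivial_adjoint (U_group 1) (d i) (R i)) \<longrightarrow>
        \<not> (k_uniform n d 2 \<psi> \<and> invariant_state n d (U_group 1) R \<psi>)) \<and>
     (\<forall>R. (\<forall>i\<in>{1..n}. cont_rep 2 (SU_group 2) (d i) (R i)) \<and>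
          (\<exists>i\<in>{1..n}. nontrivial_adjoint (SU_group 2) (d i) (R i)) \<longrightarrow>
        \<not> (k_uniform n d 2 \<psi> \<and> invariant_state n d (SU_group 2) R \<psi>)) \<and>
     (\<forall>D. (\<forall>i\<in>{1..n}. d i = D) \<and>
          (\<exists>i\<in>{1..n}. nontrivial_adjoint (U_group D) (d i) (\<lambda>g. g)) \<longrightarrow>
        \<not> (k_uniform n d 2 \<psi> \<and> invariant_state n d (U_group D) (\<lambda>i g. g) \<psi>)) \<and>
     (n \<ge> 4 \<longrightarrow>
       (\<forall>R. (\<forall>i\<in>{1..n}. cont_rep 2 (SU_group 2) (d i) (R i) \<and>
                         irreducible_rep (SU_group 2) (d i) (R i)) \<and>
            (\<exists>i\<in>{1..n}. nontrivial_adjoint (SU_group 2) (d i) (R i)) \<longrightarrow>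
          \<not> (AME n d \<psi> \<and> invariant_state n d (SU_group 2) R \<psi>)))"
proof -
  have loc: "two_uniform_state n d \<psi>" if "k_uniform n d 2 \<psi>"
    using assms that by unfold_locales
  have U1: "\<not> (k_uniform n d 2 \<psi> \<and> invariant_state n d (U_group 1) R \<psi>)"
    if "\<forall>i\<in>{1..n}. cont_rep 1 (U_group 1) (d i) (R i)"
      "\<exists>i\<in>{1..n}. nontrivial_adjoint (U_group 1) (d i) (R i)" for R
    using two_uniform_state.invariant_adjoint_trivial[OF loc _ _ group_simps(2) U_1_covered] that
    by blast
  have SU2: "\<not> (k_uniform n d 2 \<psi> \<and> invariant_state n d (SU_group 2) R \<psi>)"
    if "\<forall>i\<in>{1..n}. cont_rep 2 (SU_group 2) (d i) (R i)"
      "\<exists>i\<in>{1..n}. nontrivial_adjoint (SU_group 2) (d i) (R i)" for R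
    using two_uniform_state.invariant_adjoint_trivial[OF loc _ _ group_simps(3) SU_2_covered] that
    by blast
  have UD: "\<not> (k_uniform n d 2 \<psi> \<and> invariant_state n d (U_group D) (\<lambda>i g. g) \<psi>)"
    if "\<forall>i\<in>{1..n}. d i = D" "\<exists>i\<in>{1..n}. nontrivial_adjoint (U_group D) (d i) (\<lambda>g. g)" for D
    using two_uniform_state.fundamental_adjoint_trivial[OF loc] that by blast
  \<comment> \<open>The bound \<open>n \<ge> 4\<close> gives \<open>2 \<le> n div 2\<close>, and
    uniformity descends to smaller sets of parties.\<close>
  have AME2: "k_uniform n d 2 \<psi>" if "AME n d \<psi>" "n \<ge> 4"
    using that k_uniform_mono[of n d "n div 2" \<psi> 2] unfolding AME_def by auto
  show ?thesis using U1 SU2 UD AME2 by blast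
qed

end
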